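(* Consider the isosceles Schwarzschild three body problem in regularized coordinates $(r,v,\theta,w)$, under the parameter assumptions stated in the context. Let $h<0$ be fixed. Then any solution (on the energy level $h$) with an initial condition $(r_0,v_0,\theta_0,w_0)$, $r_0>0$, $|\theta_0|<\pi/2$, such that $$2r_0^2\,\tilde V(0)<\frac{C^2}{2}\quad\text{and}\quad v_0<-\sqrt{2W(0)},\qquad\text{where }\ \tilde V(\theta):=V(\theta)\cos\theta,$$ tends to one of the sets $\mathcal B_{\pm}(r)$ with $0\le r<r_0$. If the limit is $\mathcal B_{\pm}(0)$, then the triple collision is reached after $m$ crosses the horizontal plane a finite number of times.
   Context: Two equal point masses $M$ move in a horizontal plane symmetrically about their midpoint $O$, and a third point mass $m$ moves on the vertical axis through $O$. The mutual interactions are of Schwarzschild type, with potential $U_0(R,z)=-\frac{A}{R}-\frac{B}{R^3}-\frac{4A_1}{(R^2+4z^2)^{1/2}}-\frac{16B_1}{(R^2+4z^2)^{3/2}}$, $A,A_1,B,B_1>0$, where $R$ is the distance between the equal masses and $z$ the height of $m$. $C$ is the angular momentum and $h$ the total energy. Put $\mu:=\frac{2M+m}{m}$. It is assumed that $M\gg m$ (so $\mu\gg1$), $\mu>1+\frac{A}{4A_1}$, $\mu>1+\frac{B}{16B_1}$ and $(\mu-1)^{4/15}\left(\frac{4A_1}{A}\right)^{2/3}\neq\left(\frac{16B_1}{B}\right)^{2/5}$. One sets $R=r\sqrt{2/M}\,\cos\theta$, $z=r\sqrt{\frac{2M+m}{2Mm}}\,\sin\theta$ with $r\ge0$, $\theta\in[-\pi/2,\pi/2]$;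 $v$ and $w$ are rescaled velocity variables. Let $$V(\theta)=\left(\tfrac M2\right)^{1/2}\left(\tfrac{A}{\cos\theta}+\tfrac{4A_1}{(\cos^2\theta+\mu\sin^2\theta)^{1/2}}\right),\qquad W(\theta)=\left(\tfrac M2\right)^{3/2}\left(\tfrac{B}{\cos^3\theta}+\tfrac{16B_1}{(\cos^2\theta+\mu\sin^2\theta)^{3/2}}\right),$$ and $U(\theta)=W(\theta)\cos^3\theta>0$. (The functions $U$, $\tilde V$ and products such as $V\cos^3\theta$, $V'\cos^6\theta$ are extended continuously to $\theta=\pm\pi/2$.) The regularized equations of motion on $[0,\infty)\times\mathbb R\times[-\pi/2,\pi/2]\times\mathbb R$ are $$r'=rv\,\frac{\cos^3\theta}{\sqrt{U(\theta)}},\qquad v'=\left(\frac{\cos^3\theta}{2\sqrt{U(\theta)}}v^2-\sqrt{U(\theta)}\right)+r^2\left(2hr+V(\theta)\right)\frac{\cos^3\theta}{\sqrt{U(\theta)}},\qquad \theta'=w,$$ $$w'=\frac12 vw\frac{\cos^3\theta}{\sqrt{U(\theta)}}+r^2V'(\theta)\frac{\cos^6\theta}{U(\theta)}+\frac{U'(\theta)}{U(\theta)}\left(\cos^3\theta-\frac{w^2}{2}\right)+3\sin\theta\cos^2\theta-\frac{C^2r\sin\theta\cos^3\theta}{U(\theta)},$$ together with the energy relation $$2hr^3\cos^6\theta=U(\theta)w^2+\left(v^2\cos^3\theta-2U(\theta)\right)\cos^3\theta+\left(C^2-2rV(\theta)\cos^2\theta\right)r\cos^4\theta .$$ Triple collision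 corresponds to $r=0$. For $\rho\ge0$, $\mathcal B_\pm(\rho)=\{(r,v,\theta,w): r=\rho,\ \theta=\pm\frac\pi2,\ w=0\}$; for $\rho>0$ these correspond to double collisions of the equal masses while $m$ is above, respectively below, the horizontal plane, and $\mathcal B_\pm(0)$ lie in the triple collision manifold $\{r=0,\ w^2+\frac{\cos^6\theta}{U(\theta)}v^2=2\cos^3\theta\}$. The mass $m$ crosses the horizontal plane when $\theta$ changes sign. "Tends to" means that the solution asymptotically approaches the set as the regularized time increases.
   Formalization: The condition 2r_0^2 Ṽ(0) < C^2/2 is corrected to 2r_0 Ṽ(0) < C^2/2 (as printed the claim fails for some r_0<1), and the equation for w' carries the extra term -3w^2 tan θ, without which the displayed equations contradict the energy relation. *)

theory Defs
  imports "HOL-Analysis.Analysis"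
begin

type_synonym state = "real \<times> real \<times> real \<times> real"

locale schwarzschild_isosceles =
  fixes M m A A1 B B1 :: real
  assumes masses_pos: "M > 0" "m > 0"
    and coeffs_pos: "A > 0" "A1 > 0" "B > 0" "B1 > 0"
    and mu_gt_V: "(2 * M + m) / m > 1 + A / (4 * A1)"
    and mu_gt_W: "(2 * M + m) / m > 1 + B / (16 * B1)"
    and nonresonance:
      "((2 * M + m) / m - 1) powr (4 / 15) * (4 * A1 / A) powr (2 / 3)
        \<noteq> (16 * B1 / B) powr (2 / 5)"
begin

definition \<mu> :: real where
  "\<mu> = (2 * M + m) / m"

definition V :: "real \<Rightarrow> real" where
  "V \<theta> = (M / 2) powr (1 / 2) *
     (A / cos \<theta> + 4 * A1 / ((cos \<theta>)\<^sup>2 + \<mu> * (sin \<theta>)\<^sup>2) powr (1 / 2))"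

definition W :: "real \<Rightarrow> real" where
  "W \<theta> = (M / 2) powr (3 / 2) *
     (B / cos \<theta> ^ 3 + 16 * B1 / ((cos \<theta>)\<^sup>2 + \<mu> * (sin \<theta>)\<^sup>2) powr (3 / 2))"

text \<open>The continuous extensions of \<open>W \<theta> * cos \<theta> ^ 3\<close> and \<open>V \<theta> * cos \<theta>\<close> to
  \<open>cos \<theta> = 0\<close>; see \<open>U_eq\<close>, \<open>isCont_U\<close>, \<open>Vt_eq\<close>, \<open>isCont_Vt\<close>.\<close>

definition U :: "real \<Rightarrow> real" where
  "U \<theta> = (M / 2) powr (3 / 2) *
     (B + 16 * B1 * cos \<theta> ^ 3 / ((cos \<theta>)\<^sup>2 + \<mu> * (sin \<theta>)\<^sup>2) powr (3 / 2))"

definition Vt :: "real \<Rightarrow> real" where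
  "Vt \<theta> = (M / 2) powr (1 / 2) *
     (A + 4 * A1 * cos \<theta> / ((cos \<theta>)\<^sup>2 + \<mu> * (sin \<theta>)\<^sup>2) powr (1 / 2))"

text \<open>At \<open>\<theta> = \<plusminus>pi/2\<close> the functions \<open>V \<theta> * cos \<theta> ^ 3\<close>, \<open>deriv V \<theta> * cos \<theta> ^ 6\<close> and
  \<open>w\<^sup>2 * tan \<theta>\<close> occurring below evaluate to 0, which is their continuous extension
  (for the last one, on a fixed energy level, where \<open>w\<^sup>2 = O(cos \<theta> ^ 3)\<close>).

  In terms of the velocity \<open>u\<close> of \<open>\<theta>\<close> in the time before regularization,
  \<open>w = u * cos \<theta> ^ 3 / sqrt (U \<theta>)\<close>. Differentiating the factor \<open>cos \<theta> ^ 3\<close> produces the term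
  \<open>- 3 * w\<^sup>2 * tan \<theta>\<close>. Without it the energy relation would not be invariant; see
  \<open>energy_defect_deriv\<close>.\<close>

definition field :: "real \<Rightarrow> real \<Rightarrow> state \<Rightarrow> state" where
  "field h C = (\<lambda>(r, v, \<theta>, w).
     (r * v * (cos \<theta> ^ 3 / sqrt (U \<theta>)),
      (cos \<theta> ^ 3 / (2 * sqrt (U \<theta>)) * v\<^sup>2 - sqrt (U \<theta>))
        + r\<^sup>2 * (2 * h * r + V \<theta>) * (cos \<theta> ^ 3 / sqrt (U \<theta>)),
      w,
      1 / 2 * v * w * (cos \<theta> ^ 3 / sqrt (U \<theta>))
        + r\<^sup>2 * deriv V \<theta> * (cos \<theta> ^ 6 / U \<theta>)
        + deriv U \<theta> / U \<theta> * (cos \<theta> ^ 3 - w\<^sup>2 / 2)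
        + 3 * sin \<theta> * (cos \<theta>)\<^sup>2 - 3 * w\<^sup>2 * tan \<theta>
        - C\<^sup>2 * r * sin \<theta> * cos \<theta> ^ 3 / U \<theta>))"

definition energy_relation :: "real \<Rightarrow> real \<Rightarrow> state \<Rightarrow> bool" where
  "energy_relation h C = (\<lambda>(r, v, \<theta>, w).
     2 * h * r ^ 3 * cos \<theta> ^ 6 =
       U \<theta> * w\<^sup>2 + (v\<^sup>2 * cos \<theta> ^ 3 - 2 * U \<theta>) * cos \<theta> ^ 3
       + (C\<^sup>2 - 2 * r * V \<theta> * (cos \<theta>)\<^sup>2) * r * cos \<theta> ^ 4)"

definition phase_space :: "state set" where
  "phase_space = {0..} \<times> UNIV \<times> {- (pi / 2)..pi / 2} \<times> UNIV"

definition motion_on :: "real \<Rightarrow> real \<Rightarrow> ereal \<Rightarrow> (real \<Rightarrow> state) \<Rightarrow> bool" where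
  "motion_on h C T x \<longleftrightarrow>
     (\<forall>t. 0 \<le> t \<and> ereal t < T \<longrightarrow>
        x t \<in> phase_space \<and> energy_relation h C (x t) \<and>
        (x has_vector_derivative field h C (x t)) (at t within {0..}))"

definition maximal_motion :: "real \<Rightarrow> real \<Rightarrow> ereal \<Rightarrow> (real \<Rightarrow> state) \<Rightarrow> bool" where
  "maximal_motion h C T x \<longleftrightarrow>
     0 < T \<and> motion_on h C T x \<and>
     \<not> (\<exists>T' y. T < T' \<and> motion_on h C T' y \<and> (\<forall>t. 0 \<le> t \<and> ereal t < T \<longrightarrow> y t = x t))"

end

definition B_plus :: "real \<Rightarrow> state set" where
  "B_plus \<rho> = {(r, v, \<theta>, w). r = \<rho> \<and> \<theta> = pi / 2 \<and> w = 0}"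

definition B_minus :: "real \<Rightarrow> state set" where
  "B_minus \<rho> = {(r, v, \<theta>, w). r = \<rho> \<and> \<theta> = - (pi / 2) \<and> w = 0}"

definition towards :: "ereal \<Rightarrow> real filter" where
  "towards T = (if T = \<infinity> then at_top else at_left (real_of_ereal T))"

definition tends_to_set :: "(real \<Rightarrow> state) \<Rightarrow> ereal \<Rightarrow> state set \<Rightarrow> bool" where
  "tends_to_set x T S \<longleftrightarrow> ((\<lambda>t. infdist (x t) S) \<longlongrightarrow> 0) (towards T)"

definition angle :: "state \<Rightarrow> real" where
  "angle = (\<lambda>(r, v, \<theta>, w). \<theta>)"

definition plane_crossings :: "(real \<Rightarrow> state) \<Rightarrow> ereal \<Rightarrow> real set" where
  "plane_crossings x T =
     {t. 0 < t \<and> ereal t < T \<and> angle (x t) = 0 \<and>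
         (\<forall>\<epsilon>>0. \<exists>s s'. 0 < s \<and> ereal s < T \<and> \<bar>s - t\<bar> < \<epsilon> \<and> 0 < s' \<and> ereal s' < T \<and> \<bar>s' - t\<bar> < \<epsilon> \<and>
                angle (x s) < 0 \<and> 0 < angle (x s'))}"

context schwarzschild_isosceles
begin

lemma mu_pos: "\<mu> > 0"
  using masses_pos by (simp add: \<mu>_def)

lemma denom_pos: "(cos \<theta>)\<^sup>2 + \<mu> * (sin \<theta>)\<^sup>2 > 0"
proof (cases "cos \<theta> = 0")
  case True
  then have "sin \<theta> \<noteq> 0" using sin_zero_abs_cos_one by force
  then show ?thesis using mu_pos by (simp add: True)
next
  case False
  then show ?thesis using mu_pos by (simp add: add_pos_nonneg)
qed

lemma U_eq: "cos \<theta> \<noteq> 0 \<Longrightarrow> U \<theta> = W \<theta> * cos \<theta> ^ 3"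
  by (simp add: U_def W_def field_simps)

lemma Vt_eq: "cos \<theta> \<noteq> 0 \<Longrightarrow> Vt \<theta> = V \<theta> * cos \<theta>"
  by (simp add: Vt_def V_def field_simps)

lemma isCont_U: "isCont U \<theta>"
  unfolding U_def using denom_pos[of \<theta>] by (intro continuous_intros) auto

lemma isCont_Vt: "isCont Vt \<theta>"
  unfolding Vt_def using denom_pos[of \<theta>] by (intro continuous_intros) auto

lemma U_pos: assumes "cos \<theta> \<ge> 0" shows "U \<theta> > 0"
proof -
  have "16 * B1 * cos \<theta> ^ 3 / ((cos \<theta>)\<^sup>2 + \<mu> * (sin \<theta>)\<^sup>2) powr (3 / 2) \<ge> 0"
    using assms coeffs_pos by (intro divide_nonneg_nonneg mult_nonneg_nonneg) auto
  then show ?thesis unfolding U_def using masses_pos coeffs_pos by (intro mult_pos_pos) auto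
qed

lemma U_deriv: "(U has_real_derivative deriv U \<theta>) (at \<theta>)"
proof -
  have "\<exists>D. (U has_real_derivative D) (at \<theta>)"
    unfolding U_def using denom_pos[of \<theta>]
    by (intro exI) (auto intro!: derivative_eq_intros)
  then show ?thesis by (metis DERIV_imp_deriv)
qed

lemma V_deriv: assumes "cos \<theta> \<noteq> 0" shows "(V has_real_derivative deriv V \<theta>) (at \<theta>)"
proof -
  have "\<exists>D. (V has_real_derivative D) (at \<theta>)"
    unfolding V_def using denom_pos[of \<theta>] assms
    by (intro exI) (auto intro!: derivative_eq_intros)
  then show ?thesis by (metis DERIV_imp_deriv)
qed

definition energy_defect :: "real \<Rightarrow> real \<Rightarrow> state \<Rightarrow> real" where
  "energy_defect h C = (\<lambda>(r, v, \<theta>, w).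
     U \<theta> * w\<^sup>2 + (v\<^sup>2 * cos \<theta> ^ 3 - 2 * U \<theta>) * cos \<theta> ^ 3
       + (C\<^sup>2 - 2 * r * V \<theta> * (cos \<theta>)\<^sup>2) * r * cos \<theta> ^ 4
       - 2 * h * r ^ 3 * cos \<theta> ^ 6)"

lemma energy_defect_eq_0: "energy_relation h C s \<longleftrightarrow> energy_defect h C s = 0"
  by (auto simp: energy_relation_def energy_defect_def split: prod.splits)

lemma energy_defect_deriv:
  fixes r v \<theta> w :: "real \<Rightarrow> real"
  assumes d: "((\<lambda>t. (r t, v t, \<theta> t, w t)) has_vector_derivative
               field h C (r t, v t, \<theta> t, w t)) (at t within S)"
    and th: "cos (\<theta> t) > 0"
  shows "((\<lambda>t. energy_defect h C (r t, v t, \<theta> t, w t)) has_real_derivative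
           (v t * cos (\<theta> t) ^ 3 / sqrt (U (\<theta> t)) - 6 * w t * tan (\<theta> t))
           * energy_defect h C (r t, v t, \<theta> t, w t)) (at t within S)"
proof -
  obtain fr fv fw where f: "field h C (r t, v t, \<theta> t, w t) = (fr, fv, w t, fw)"
    by (auto simp: field_def)
  note D = d[unfolded f]
  have dr: "(r has_real_derivative fr) (at t within S)"
    using bounded_linear.has_vector_derivative[OF bounded_linear_fst D]
    by (simp add: has_real_derivative_iff_has_vector_derivative)
  note D2 = bounded_linear.has_vector_derivative[OF bounded_linear_snd D, simplified]
  have dv: "(v has_real_derivative fv) (at t within S)"
    using bounded_linear.has_vector_derivative[OF bounded_linear_fst D2]
    by (simp add: has_real_derivative_iff_has_vector_derivative)
  note D3 = bounded_linear.has_vector_derivative[OF bounded_linear_snd D2, simplified]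
  have dth: "(\<theta> has_real_derivative w t) (at t within S)"
    using bounded_linear.has_vector_derivative[OF bounded_linear_fst D3]
    by (simp add: has_real_derivative_iff_has_vector_derivative)
  have dw: "(w has_real_derivative fw) (at t within S)"
    using bounded_linear.has_vector_derivative[OF bounded_linear_snd D3]
    by (simp add: has_real_derivative_iff_has_vector_derivative)
  have dU: "((\<lambda>t. U (\<theta> t)) has_real_derivative deriv U (\<theta> t) * w t) (at t within S)"
    by (rule DERIV_chain2[OF U_deriv dth])
  have dV: "((\<lambda>t. V (\<theta> t)) has_real_derivative deriv V (\<theta> t) * w t) (at t within S)"
    using DERIV_chain2[OF V_deriv dth] th by auto
  define c s q where "c = cos (\<theta> t)" "s = sin (\<theta> t)" "q = sqrt (U (\<theta> t))"
  have q: "q > 0" "U (\<theta> t) = q\<^sup>2" using U_pos[of "\<theta> t"] th by (auto simp: c_s_q_def)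
  have c: "c > 0" "tan (\<theta> t) = s / c" using th by (auto simp: c_s_q_def tan_def)
  define G where "G = deriv U (\<theta> t)"
  define H where "H = deriv V (\<theta> t)"
  define V0 where "V0 = V (\<theta> t)"
  have fr: "fr = r t * v t * (c ^ 3 / q)"
    and fv: "fv = (c ^ 3 / (2 * q) * (v t)\<^sup>2 - q) + (r t)\<^sup>2 * (2 * h * r t + V0) * (c ^ 3 / q)"
    and fw: "fw = 1 / 2 * v t * w t * (c ^ 3 / q) + (r t)\<^sup>2 * H * (c ^ 6 / q\<^sup>2)
        + G / q\<^sup>2 * (c ^ 3 - (w t)\<^sup>2 / 2) + 3 * s * c\<^sup>2 - 3 * (w t)\<^sup>2 * (s / c)
        - C\<^sup>2 * r t * s * c ^ 3 / q\<^sup>2"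
    using f U_pos[of "\<theta> t"] th
    by (auto simp: field_def G_def H_def V0_def c_s_q_def tan_def)
  show ?thesis
    unfolding energy_defect_def prod.case
    apply (rule derivative_eq_intros dr dv dth dw dU dV refl)+
    unfolding c(2) q(2) fr fv fw c_s_q_def[symmetric] G_def[symmetric] H_def[symmetric] V0_def[symmetric]
    using q(1) c(1)
    by (simp add: divide_simps) algebra
qed

end

end

theory Submission
  imports Defs
begin

text \<open>
  Write \<open>c = cos \<theta>\<close> and eliminate \<open>v\<^sup>2\<close> from the equation for \<open>v'\<close> by means of the energy relation:
  \<open>v' = - (U w\<^sup>2 / c ^ 3 + r c (C\<^sup>2 - 4 r Vt c) - 6 h r ^ 3 c ^ 3) / (2 sqrt U)\<close>.
  As \<open>Vt\<close> is largest at \<open>\<theta> = 0\<close>, \<open>h < 0\<close> and the condition on \<open>r0\<close> make every summand nonnegative as long as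
  \<open>r \<le> r0\<close>. So \<open>v\<close> decreases, hence stays negative, hence \<open>r\<close> decreases, and
  the situation perpetuates itself. The energy relation also gives \<open>v\<^sup>2 \<le> 2 W \<theta>\<close>. Since \<open>v\<^sup>2 > 2 W 0\<close>
  from the start, the angle can never return to 0: the mass \<open>m\<close> does not cross the plane at all, and
  the motion is confined to one of the two regions \<open>W \<theta> > W 0\<close> around \<open>\<theta> = \<plusminus>pi/2\<close>.

  It remains to see that \<open>c \<rightarrow> 0\<close>; as \<open>w\<^sup>2 = O(c ^ 3)\<close>, the limit of \<open>w\<close> is then 0, and
  \<open>r\<close> converges because it is monotone. If \<open>v\<close> is unbounded, \<open>v\<^sup>2 c ^ 3 \<le> 2 U\<close> forces \<open>c \<rightarrow> 0\<close>.
  If \<open>v\<close> is bounded, then \<open>w sin \<theta>\<close> is nearly a Lyapunov function. The function \<open>W\<close> is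
  convex in \<open>tan\<^sup>2 \<theta>\<close>, so in these regions its gradient pushes the motion away from the plane (\<open>W_convexity\<close>); the remaining
  terms in the derivative of \<open>w sin \<theta>\<close> are controlled by \<open>w\<^sup>2 / c ^ 3\<close> and \<open>r c\<close>, that is, by \<open>- v'\<close>
  (\<open>w'_outward\<close>). Hence \<open>w sin \<theta> - N v\<close> is bounded and, for large \<open>N\<close>, has derivative at least \<open>\<eta> c\<^sup>2\<close>,
  which again leads to \<open>c \<rightarrow> 0\<close>.

  All of this presupposes that the motion exists for all times. The bound \<open>w = O(c)\<close> prevents
  \<open>c\<close> from vanishing in finite time, so on a finite time interval the state remains in a compact
  set of states with \<open>r > 0\<close> and \<open>c > 0\<close>. The field is locally Lipschitz there, and the
  Picard-Lindeloef theorem continues the motion; \<open>energy_defect_deriv\<close> shows that the continuation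
  stays on the energy level.
\<close>

section \<open>Continuation of solutions of autonomous equations\<close>

text \<open>Composing \<open>f\<close> with the projection onto the ball makes it globally Lipschitz, so that the
  Picard operator acts on all bounded continuous functions and contracts for a short time interval.
  The fixed point does not leave the ball, where the projection is the identity.\<close>

lemma picard_local_solution:
  fixes f :: "'a::euclidean_space \<Rightarrow> 'a"
  assumes lip: "L-lipschitz_on (cball p e) f" and e: "e > 0"
  obtains \<delta> z where "\<delta> > 0" "z 0 = p" "continuous_on {0..\<delta>} z"
    "\<And>t. t \<in> {0..\<delta>} \<Longrightarrow> z t \<in> cball p e"
    "\<And>t. t \<in> {0<..<\<delta>} \<Longrightarrow> (z has_vector_derivative f (z t)) (at t)"
proof -
  define B where "B = cball p e"
  define g where "g = f \<circ> closest_point B"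
  have B: "convex B" "closed B" "B \<noteq> {}" "p \<in> B" using e by (auto simp: B_def)
  have inB: "closest_point B y \<in> B" for y using B closest_point_in_set by blast
  have L0: "L \<ge> 0" using lip lipschitz_on_nonneg by blast
  have glip: "norm (g y - g y') \<le> L * norm (y - y')" for y y'
  proof -
    have "dist (g y) (g y') \<le> L * dist (closest_point B y) (closest_point B y')"
      using lipschitz_onD[OF lip, folded B_def] inB by (simp add: g_def)
    also have "\<dots> \<le> L * dist y y'"
      using closest_point_lipschitz[OF B(1-3)] L0 by (intro mult_left_mono) auto
    finally show ?thesis by (simp add: dist_norm)
  qed
  have "L-lipschitz_on UNIV g" using glip L0 by (intro lipschitz_onI) (auto simp: dist_norm)
  then have gcont: "continuous_on UNIV g" by (rule lipschitz_on_continuous_on)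
  define N where "N = norm (f p) + L * e"
  have N0: "N \<ge> 0" using L0 e by (simp add: N_def)
  have gb: "norm (g y) \<le> N" for y
  proof -
    have "norm (f (closest_point B y) - f p) \<le> L * norm (closest_point B y - p)"
      using lipschitz_on_normD[OF lip, folded B_def] inB B(4) by blast
    also have "\<dots> \<le> L * e" using inB[of y] L0
      by (intro mult_left_mono) (auto simp: B_def dist_norm norm_minus_commute)
    finally show ?thesis
      using norm_triangle_sub[of "f (closest_point B y)" "f p"] by (simp add: N_def g_def)
  qed
  define \<delta> where "\<delta> = min (1 / (2 * (L + 1))) (e / (N + 1))"
  have \<delta>: "\<delta> > 0" using L0 N0 e by (simp add: \<delta>_def)
  have \<delta>L: "\<delta> * L \<le> 1 / 2"
  proof -
    have "\<delta> * L \<le> 1 / (2 * (L + 1)) * L" using L0 by (intro mult_right_mono) (auto simp: \<delta>_def)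
    also have "\<dots> \<le> 1 / 2" using L0 by (simp add: field_simps)
    finally show ?thesis .
  qed
  have \<delta>N: "\<delta> * N \<le> e"
  proof -
    have "\<delta> * N \<le> e / (N + 1) * N" using N0 by (intro mult_right_mono) (auto simp: \<delta>_def)
    also have "\<dots> \<le> e" using N0 e by (simp add: field_simps)
    finally show ?thesis .
  qed
  \<comment> \<open>Clamping the time to \<open>{0..\<delta>}\<close> lets the operator act on functions defined on the whole line.\<close>
  define cl where "cl = (\<lambda>t::real. max 0 (min t \<delta>))"
  have cl: "0 \<le> cl t" "cl t \<le> \<delta>" for t using \<delta> by (auto simp: cl_def)
  have clcont: "continuous_on UNIV cl" unfolding cl_def by (intro continuous_intros)
  define \<Phi> where "\<Phi> = (\<lambda>(u :: real \<Rightarrow>\<^sub>C 'a) t. p + integral {0..cl t} (\<lambda>s. g (u s)))"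
  have gu: "continuous_on S (\<lambda>s. g (apply_bcontfun u s))" for u :: "real \<Rightarrow>\<^sub>C 'a" and S
    by (rule continuous_on_compose2[OF gcont]) auto
  have gui: "(\<lambda>s. g (apply_bcontfun u s)) integrable_on {a..b}" for u :: "real \<Rightarrow>\<^sub>C 'a" and a b
    by (rule integrable_continuous_real[OF gu])
  have intb: "norm (integral {0..cl t} (\<lambda>s. g (apply_bcontfun u s))) \<le> \<delta> * N" for u t
  proof -
    have "norm (integral {0..cl t} (\<lambda>s. g (apply_bcontfun u s))) \<le> N * (cl t - 0)"
      using cl gb gu by (intro integral_bound) auto
    also have "\<dots> \<le> N * \<delta>" using cl[of t] N0 by (intro mult_left_mono) auto
    finally show ?thesis by (simp add: mult.commute)
  qed
  have \<Phi>c: "\<Phi> u \<in> bcontfun" for u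
  proof (rule bcontfun_normI)
    have "continuous_on {0..\<delta>} (\<lambda>t. integral {0..t} (\<lambda>s. g (apply_bcontfun u s)))"
      by (rule indefinite_integral_continuous_1[OF gui])
    then have "continuous_on UNIV (\<lambda>t. integral {0..cl t} (\<lambda>s. g (apply_bcontfun u s)))"
      by (rule continuous_on_compose2[OF _ clcont]) (use cl in auto)
    then show "continuous_on UNIV (\<Phi> u)" unfolding \<Phi>_def by (intro continuous_intros)
    show "norm (\<Phi> u t) \<le> norm p + \<delta> * N" for t
      unfolding \<Phi>_def using intb[of t u] by (intro norm_triangle_le) simp
  qed
  define F where "F = (\<lambda>u. Bcontfun (\<Phi> u))"
  have F: "apply_bcontfun (F u) = \<Phi> u" for u
    unfolding F_def by (rule Bcontfun_inverse[OF \<Phi>c])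
  have contr: "dist (F u) (F v) \<le> 1 / 2 * dist u v" for u v
  proof (rule dist_bound)
    fix t
    have "dist (\<Phi> u t) (\<Phi> v t) =
        norm (integral {0..cl t} (\<lambda>s. g (apply_bcontfun u s) - g (apply_bcontfun v s)))"
      unfolding \<Phi>_def dist_norm by (simp add: integral_diff[OF gui gui])
    also have "\<dots> \<le> (L * dist u v) * (cl t - 0)"
    proof (rule integral_bound)
      show "0 \<le> cl t" by (rule cl)
      show "continuous_on {0..cl t} (\<lambda>s. g (apply_bcontfun u s) - g (apply_bcontfun v s))"
        by (intro continuous_intros gu)
      fix s
      have "norm (g (apply_bcontfun u s) - g (apply_bcontfun v s)) \<le> L * dist (apply_bcontfun u s) (apply_bcontfun v s)"
        using glip by (simp add: dist_norm)
      also have "\<dots> \<le> L * dist u v" 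
        by (rule mult_left_mono[OF dist_bounded L0])
      finally show "norm (g (apply_bcontfun u s) - g (apply_bcontfun v s)) \<le> L * dist u v" .
    qed
    also have "\<dots> \<le> (L * dist u v) * \<delta>" 
      using L0 cl[of t] by (intro mult_left_mono) auto
    also have "\<dots> \<le> 1 / 2 * dist u v"
      using mult_right_mono[OF \<delta>L, of "dist u v"] by (simp add: mult_ac)
    finally show "dist (apply_bcontfun (F u) t) (apply_bcontfun (F v) t) \<le> 1 / 2 * dist u v"
      by (simp add: F)
  qed
  obtain u where u: "F u = u"
    using banach_fix_type[of "1/2" F] contr by auto
  define z where "z = apply_bcontfun u"
  have z: "z t = p + integral {0..cl t} (\<lambda>s. g (z s))" for t
    using fun_cong[OF F[of u, unfolded u], of t] unfolding z_def \<Phi>_def .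
  have zB: "z t \<in> B" for t
  proof -
    have "dist p (z t) = norm (integral {0..cl t} (\<lambda>s. g (z s)))"
      unfolding z[of t] by (simp add: dist_norm)
    then show ?thesis using intb[of t u] \<delta>N by (simp add: B_def z_def)
  qed
  then have gz: "g (z t) = f (z t)" for t
    by (simp add: g_def closest_point_self)
  have "(z has_vector_derivative f (z t)) (at t)" if t: "t \<in> {0<..<\<delta>}" for t
  proof -
    have "((\<lambda>t. integral {0..t} (\<lambda>s. g (z s))) has_vector_derivative g (z t)) (at t within {0..\<delta>})"
      unfolding z_def using t by (intro integral_has_vector_derivative gu) auto
    then have "((\<lambda>t. integral {0..t} (\<lambda>s. g (z s))) has_vector_derivative g (z t)) (at t)"
      using t by (simp add: at_within_Icc_at)
    then have D: "((\<lambda>t. p + integral {0..t} (\<lambda>s. g (z s))) has_vector_derivative g (z t)) (at t)"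
      by (auto intro!: derivative_eq_intros)
    have eq: "p + integral {0..s} (\<lambda>s. g (z s)) = z s" if "s \<in> {0<..<\<delta>}" for s
      using z[of s] that by (simp add: cl_def)
    from D have "(z has_vector_derivative g (z t)) (at t)"
      by (rule has_vector_derivative_transform_within_open[of _ _ _ "{0<..<\<delta>}"])
        (use t eq in simp_all)
    then show ?thesis by (simp add: gz)
  qed
  moreover have "z 0 = p" using z[of 0] \<delta> by (simp add: cl_def)
  moreover have "continuous_on {0..\<delta>} z" by (simp add: z_def)
  ultimately show ?thesis using that[of \<delta> z] \<delta> zB by (auto simp: B_def)
qed

text \<open>A pointwise notion with a ball of unspecified radius, so that it is closed under composition and products
  without bookkeeping of domains.\<close>

definition lipschitz_near :: "'a::metric_space \<Rightarrow> ('a \<Rightarrow> 'b::metric_space) \<Rightarrow> bool" where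
  "lipschitz_near p f \<longleftrightarrow> (\<exists>e>0. \<exists>L. L-lipschitz_on (ball p e) f)"

lemma lipschitz_near_isCont: "lipschitz_near p f \<Longrightarrow> isCont f p"
  unfolding lipschitz_near_def
  using lipschitz_on_continuous_on continuous_on_interior[of "ball p _" f p]
  by (metis centre_in_ball interior_ball)

text \<open>A solution in a compact set has bounded speed, so it is Lipschitz and has a limit at
  the final time; a local solution from that limit is appended. Passing to the integral
  equation gives the derivative at the junction.\<close>

lemma bounded_solution_extends:
  fixes f :: "'a::euclidean_space \<Rightarrow> 'a"
  assumes f: "\<And>p. p \<in> \<Omega> \<Longrightarrow> lipschitz_near p f" and \<Omega>: "open \<Omega>"
    and K: "compact K" "K \<subseteq> \<Omega>" and T: "T > 0"
    and x: "\<And>t. 0 \<le> t \<Longrightarrow> t < T \<Longrightarrow> x t \<in> K"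
    and dx: "\<And>t. 0 \<le> t \<Longrightarrow> t < T \<Longrightarrow> (x has_vector_derivative f (x t)) (at t within {0..})"
  obtains T' y where "T' > T" "\<And>t. 0 \<le> t \<Longrightarrow> t < T \<Longrightarrow> y t = x t"
    "\<And>t. 0 \<le> t \<Longrightarrow> t < T' \<Longrightarrow> y t \<in> \<Omega>"
    "\<And>t. 0 \<le> t \<Longrightarrow> t < T' \<Longrightarrow> (y has_vector_derivative f (y t)) (at t within {0..})"
proof -
  have fc: "continuous_on \<Omega> f"
    by (intro continuous_at_imp_continuous_on ballI lipschitz_near_isCont f)
  have "bounded (f ` K)"
    using K fc by (intro compact_imp_bounded compact_continuous_image) (auto intro: continuous_on_subset)
  then obtain N where N: "\<And>p. p \<in> K \<Longrightarrow> norm (f p) \<le> N" by (auto simp: bounded_iff)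
  have N0: "N \<ge> 0" using order_trans[OF norm_ge_zero N[OF x[of 0]]] T by simp
  have dx': "(x has_vector_derivative f (x t)) (at t within {0..<T})" if "t \<in> {0..<T}" for t
    using that by (intro has_vector_derivative_within_subset[OF dx]) auto
  have "N-lipschitz_on {0..<T} x"
  proof (rule lipschitz_onI[OF _ N0])
    fix s t assume st: "s \<in> {0..<T}" "t \<in> {0..<T}"
    have "norm (x s - x t) \<le> N * norm (s - t)"
    proof (rule differentiable_bound[of "{0..<T}" x "\<lambda>t h. h *\<^sub>R f (x t)"])
      show "(x has_derivative (\<lambda>h. h *\<^sub>R f (x t))) (at t within {0..<T})" if "t \<in> {0..<T}" for t
        using dx'[OF that] by (simp add: has_vector_derivative_def)
      show "onorm (\<lambda>h. h *\<^sub>R f (x t)) \<le> N" if "t \<in> {0..<T}" for t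
        using N[OF x[of t]] that by (intro onorm_le) (auto simp: mult.commute[of N] mult_left_mono)
    qed (use st in auto)
    then show "dist (x s) (x t) \<le> N * dist s t" by (simp add: dist_norm)
  qed
  then have uc: "uniformly_continuous_on {0..<T} x"
    by (rule lipschitz_on_uniformly_continuous)
  have "T \<in> closure {0..<T}" using T by simp
  from uniformly_continuous_on_extension_at_closure[OF uc this]
  obtain l where l: "(x \<longlongrightarrow> l) (at T within {0..<T})" .
  have nontriv: "at T within {0..<T} \<noteq> bot"
  proof -
    have "at T within {0..<T} = at_left T"
      using T by (intro at_within_nhd[of _ "{0<..}"]) auto
    then show ?thesis by simp
  qed
  have lK: "l \<in> K"
  proof (rule Lim_in_closed_set[OF compact_imp_closed[OF K(1)] _ nontriv l])
    show "\<forall>\<^sub>F t in at T within {0..<T}. x t \<in> K"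
      using x by (auto simp: eventually_at_filter)
  qed
  obtain e1 L where e1: "e1 > 0" "L-lipschitz_on (ball l e1) f"
    using f lK K unfolding lipschitz_near_def by blast
  obtain e2 where e2: "e2 > 0" "ball l e2 \<subseteq> \<Omega>"
    using \<Omega> lK K open_contains_ball by blast
  define e where "e = min e1 e2 / 2"
  have e: "e > 0" "cball l e \<subseteq> ball l e1" "cball l e \<subseteq> \<Omega>"
    using e1 e2 by (auto simp: e_def subset_iff)
  obtain \<delta> z where \<delta>: "\<delta> > 0" and z0: "z 0 = l" and zc: "continuous_on {0..\<delta>} z"
    and zB: "\<And>t. t \<in> {0..\<delta>} \<Longrightarrow> z t \<in> cball l e"
    and dz: "\<And>t. t \<in> {0<..<\<delta>} \<Longrightarrow> (z has_vector_derivative f (z t)) (at t)"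
    using picard_local_solution[OF lipschitz_on_subset[OF e1(2) e(2)] e(1)] by blast
  define y where "y = (\<lambda>t. if t < T then x t else z (t - T))"
  have y\<Omega>: "y t \<in> \<Omega>" if "0 \<le> t" "t \<le> T + \<delta>" for t
    using that x K zB[of "t - T"] e by (auto simp: y_def)
  have xc: "continuous_on {0..<T} x" using uc by (rule uniformly_continuous_imp_continuous)
  have yc: "continuous_on {0..T + \<delta>} y"
  proof -
    have 1: "continuous_on {0..T} y"
      unfolding continuous_on_eq_continuous_within
    proof
      fix t assume t: "t \<in> {0..T}"
      show "continuous (at t within {0..T}) y"
      proof (cases "t = T")
        case True
        have "(y \<longlongrightarrow> l) (at T within {0..<T})"
          using l by (rule Lim_transform_within[of _ _ _ _ 1]) (auto simp: y_def)
        moreover have "{0..T} - {T} = {0..<T} - {T}" by auto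
        then have "at T within {0..T} = at T within {0..<T}" by (simp only: at_within_def)
        ultimately show ?thesis using True z0 by (simp add: continuous_within y_def)
      next
        case False
        then have tt: "t \<in> {0..<T}" using t by auto
        have "continuous_on {0..<T} y" using xc by (rule continuous_on_eq) (auto simp: y_def)
        then have "continuous (at t within {0..<T}) y"
          using tt by (simp add: continuous_on_eq_continuous_within)
        moreover have "at t within {0..T} = at t within {0..<T}"
          using tt by (intro at_within_nhd[of _ "{..<T}"]) auto
        ultimately show ?thesis by simp
      qed
    qed
    have 2: "continuous_on {T..T + \<delta>} y"
    proof -
      have "continuous_on {T..T + \<delta>} (\<lambda>t. z (t - T))"
        by (rule continuous_on_compose2[OF zc]) (auto intro!: continuous_intros)
      then show ?thesis by (rule continuous_on_eq) (auto simp: y_def)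
    qed
    have "{0..T + \<delta>} = {0..T} \<union> {T..T + \<delta>}" using T \<delta> by auto
    then show ?thesis using continuous_on_closed_Un[OF _ _ 1 2] by simp
  qed
  have fyc: "continuous_on {0..T + \<delta>} (\<lambda>t. f (y t))"
    by (rule continuous_on_compose2[OF fc yc]) (use y\<Omega> in auto)
  have dy: "(y has_vector_derivative f (y t)) (at t)" if "t \<in> {0<..<T + \<delta>} - {T}" for t
  proof (cases "t < T")
    case True
    have "at t within {0..} = at t"
      using that by (intro at_within_nhd[of _ "{0<..}"]) auto
    then have "(x has_vector_derivative f (x t)) (at t)"
      using dx[of t] that True by simp
    then have "(y has_vector_derivative f (x t)) (at t)"
      by (rule has_vector_derivative_transform_within_open[of _ _ _ "{..<T}"])
         (use True in \<open>auto simp: y_def\<close>)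
    then show ?thesis using True by (simp add: y_def)
  next
    case False
    then have tT: "t - T \<in> {0<..<\<delta>}" using that by auto
    have "((\<lambda>t. z (t - T)) has_vector_derivative f (z (t - T))) (at t)"
    proof -
      have "((\<lambda>t. t - T) has_vector_derivative 1) (at t)"
        by (auto intro!: derivative_eq_intros)
      from vector_diff_chain_at[OF this dz[OF tT]] show ?thesis by (simp add: o_def)
    qed
    then have "(y has_vector_derivative f (z (t - T))) (at t)"
      by (rule has_vector_derivative_transform_within_open[of _ _ _ "{T<..}"])
         (use tT in \<open>auto simp: y_def\<close>)
    then show ?thesis using False by (simp add: y_def)
  qed
  \<comment> \<open>The formula for the derivative may fail at \<open>T\<close> without harm to the integral.\<close>
  have yint: "integral {0..t} (\<lambda>t. f (y t)) = y t - y 0" if "t \<in> {0..T + \<delta>}" for t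
    by (rule integral_unique, rule fundamental_theorem_of_calculus_interior_strong[of "{T}"])
      (use that dy in \<open>auto intro: continuous_on_subset[OF yc]\<close>)
  have dy': "(y has_vector_derivative f (y t)) (at t within {0..})" if t: "0 \<le> t" "t < T + \<delta>" for t
  proof -
    have "((\<lambda>t. integral {0..t} (\<lambda>t. f (y t))) has_vector_derivative f (y t)) (at t within {0..T + \<delta>})"
      by (rule integral_has_vector_derivative[OF fyc]) (use t in auto)
    then have "((\<lambda>t. y 0 + integral {0..t} (\<lambda>t. f (y t))) has_vector_derivative f (y t)) (at t within {0..T + \<delta>})"
      by (auto intro!: derivative_eq_intros)
    then have "(y has_vector_derivative f (y t)) (at t within {0..T + \<delta>})"
      by (rule has_vector_derivative_transform[rotated 2]) (use t yint in auto)
    moreover have "at t within {0..T + \<delta>} = at t within {0..}"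
      using t by (intro at_within_nhd[of _ "{..<T + \<delta>}"]) auto
    ultimately show ?thesis by simp
  qed
  show ?thesis
    by (rule that[of "T + \<delta>" y]) (use \<delta> y\<Omega> dy' in \<open>auto simp: y_def\<close>)
qed

section \<open>Calculus of local Lipschitz continuity\<close>

lemma lipschitz_near_const [simp]: "lipschitz_near p (\<lambda>x. a)"
  unfolding lipschitz_near_def by (intro exI[of _ 1] exI[of _ 0]) (auto intro: lipschitz_intros)

lemma lipschitz_near_bounded_linear:
  assumes "bounded_linear f" shows "lipschitz_near p f"
proof -
  obtain L where "L-lipschitz_on UNIV f"
    using bounded_linear.lipschitz_boundE[OF assms] by blast
  then have "L-lipschitz_on (ball p 1) f" by (rule lipschitz_on_subset) auto
  then show ?thesis unfolding lipschitz_near_def using zero_less_one by blast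
qed

lemma lipschitz_near_common_ball:
  assumes "lipschitz_near p f" "lipschitz_near p g"
  obtains e L where "e > 0" "L \<ge> 0" "L-lipschitz_on (ball p e) f" "L-lipschitz_on (ball p e) g"
proof -
  obtain e1 L1 where 1: "e1 > 0" "L1-lipschitz_on (ball p e1) f"
    using assms(1) by (auto simp: lipschitz_near_def)
  obtain e2 L2 where 2: "e2 > 0" "L2-lipschitz_on (ball p e2) g"
    using assms(2) by (auto simp: lipschitz_near_def)
  show ?thesis
  proof (rule that[of "min e1 e2" "max L1 L2"])
    show "max L1 L2 \<ge> 0" using 1 lipschitz_on_nonneg by fastforce
    show "(max L1 L2)-lipschitz_on (ball p (min e1 e2)) f"
      by (rule lipschitz_on_mono[OF 1(2)]) auto
    show "(max L1 L2)-lipschitz_on (ball p (min e1 e2)) g"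
      by (rule lipschitz_on_mono[OF 2(2)]) auto
  qed (use 1 2 in auto)
qed

lemma lipschitz_near_Pair:
  assumes "lipschitz_near p f" "lipschitz_near p g"
  shows "lipschitz_near p (\<lambda>x. (f x, g x))"
  using lipschitz_near_common_ball[OF assms] lipschitz_on_Pair unfolding lipschitz_near_def by metis

lemma lipschitz_near_compose:
  assumes f: "lipschitz_near p f" and g: "lipschitz_near (f p) g"
  shows "lipschitz_near p (\<lambda>x. g (f x))"
proof -
  obtain e1 L1 where 1: "e1 > 0" "L1-lipschitz_on (ball p e1) f"
    using f by (auto simp: lipschitz_near_def)
  obtain e2 L2 where 2: "e2 > 0" "L2-lipschitz_on (ball (f p) e2) g"
    using g by (auto simp: lipschitz_near_def)
  have L1: "L1 \<ge> 0" using 1 lipschitz_on_nonneg by blast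
  define e where "e = min e1 (e2 / (L1 + 1))"
  have e: "e > 0" using 1 2 L1 by (simp add: e_def)
  have lf: "L1-lipschitz_on (ball p e) f"
    by (rule lipschitz_on_subset[OF 1(2)]) (auto simp: e_def)
  have "f ` ball p e \<subseteq> ball (f p) e2"
  proof safe
    fix x assume x: "x \<in> ball p e"
    have "dist (f p) (f x) \<le> L1 * dist p x" using lipschitz_onD[OF lf] x e by auto
    also have "\<dots> \<le> L1 * e" using x L1 by (intro mult_left_mono) auto
    also have "\<dots> \<le> L1 * (e2 / (L1 + 1))" using L1 by (intro mult_left_mono) (auto simp: e_def)
    also have "\<dots> < e2" using L1 2 by (simp add: field_simps)
    finally show "f x \<in> ball (f p) e2" by simp
  qed
  then have "L2-lipschitz_on (f ` ball p e) g" by (rule lipschitz_on_subset[OF 2(2)])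
  then have "(L2 * L1)-lipschitz_on (ball p e) (\<lambda>x. g (f x))"
    by (rule lipschitz_on_compose2[OF lf])
  then show ?thesis using e by (auto simp: lipschitz_near_def)
qed

lemma lipschitz_near_add:
  fixes f g :: "'a::metric_space \<Rightarrow> 'b::real_normed_vector"
  assumes "lipschitz_near p f" "lipschitz_near p g"
  shows "lipschitz_near p (\<lambda>x. f x + g x)"
  using lipschitz_near_common_ball[OF assms] lipschitz_on_add unfolding lipschitz_near_def by metis

lemma lipschitz_near_C1:
  fixes g :: "real \<Rightarrow> real"
  assumes S: "open S" "a \<in> S" and D: "\<And>y. y \<in> S \<Longrightarrow> (g has_real_derivative g' y) (at y)"
    and c: "isCont g' a"
  shows "lipschitz_near a g"
proof -
  obtain e1 where e1: "e1 > 0" "ball a e1 \<subseteq> S" using S open_contains_ball by blast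
  obtain e2 where e2: "e2 > 0" "\<And>y. dist y a < e2 \<Longrightarrow> dist (g' y) (g' a) < 1"
    using c unfolding continuous_at_eps_delta by (metis zero_less_one)
  define e where "e = min e1 e2"
  have B: "norm (g' y) \<le> \<bar>g' a\<bar> + 1" if "y \<in> ball a e" for y
    using e2(2)[of y] that by (auto simp: e_def dist_real_def abs_minus_commute)
  have "(\<bar>g' a\<bar> + 1)-lipschitz_on (ball a e) g"
  proof (rule lipschitz_onI)
    fix y z assume yz: "y \<in> ball a e" "z \<in> ball a e"
    have "norm (g y - g z) \<le> (\<bar>g' a\<bar> + 1) * norm (y - z)"
    proof (rule field_differentiable_bound[of "ball a e" g g'])
      show "(g has_field_derivative g' u) (at u within ball a e)" if "u \<in> ball a e" for u
      proof -
        have "u \<in> S" using e1(2) that by (auto simp: e_def)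
        then show ?thesis by (rule has_field_derivative_at_within[OF D])
      qed
      show "norm (g' u) \<le> \<bar>g' a\<bar> + 1" if "u \<in> ball a e" for u by (rule B[OF that])
    qed (fact convex_ball yz)+
    then show "dist (g y) (g z) \<le> (\<bar>g' a\<bar> + 1) * dist y z" by (simp add: dist_norm)
  qed auto
  moreover have "e > 0" using e1 e2 by (simp add: e_def)
  ultimately show ?thesis unfolding lipschitz_near_def by blast
qed

lemma lipschitz_near_square: "lipschitz_near a (\<lambda>x::real. x\<^sup>2)"
  by (rule lipschitz_near_C1[of UNIV _ _ "\<lambda>x. 2 * x"]) (auto intro!: derivative_eq_intros continuous_intros)

lemma lipschitz_near_cmult:
  fixes f :: "'a::metric_space \<Rightarrow> real"
  assumes "lipschitz_near p f" shows "lipschitz_near p (\<lambda>x. c * f x)"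
  by (rule lipschitz_near_compose[OF assms lipschitz_near_bounded_linear]) (rule bounded_linear_mult_right)

lemma lipschitz_near_diff:
  fixes f g :: "'a::metric_space \<Rightarrow> real"
  assumes "lipschitz_near p f" "lipschitz_near p g"
  shows "lipschitz_near p (\<lambda>x. f x - g x)"
  using lipschitz_near_add[OF assms(1) lipschitz_near_cmult[OF assms(2), of "-1"]] by simp

text \<open>By polarization, products reduce to sums and squares.\<close>

lemma lipschitz_near_mult:
  fixes f g :: "'a::metric_space \<Rightarrow> real"
  assumes f: "lipschitz_near p f" and g: "lipschitz_near p g"
  shows "lipschitz_near p (\<lambda>x. f x * g x)"
proof -
  have "lipschitz_near p (\<lambda>x. 1 / 4 * ((f x + g x)\<^sup>2 - (f x - g x)\<^sup>2))"
    by (intro lipschitz_near_cmult lipschitz_near_diff lipschitz_near_compose[OF _ lipschitz_near_square]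
        lipschitz_near_add f g)
  moreover have "(\<lambda>x. f x * g x) = (\<lambda>x. 1 / 4 * ((f x + g x)\<^sup>2 - (f x - g x)\<^sup>2))"
    by (rule ext) (simp add: power2_eq_square field_simps)
  ultimately show ?thesis by simp
qed

lemma lipschitz_near_divide:
  fixes f g :: "'a::metric_space \<Rightarrow> real"
  assumes f: "lipschitz_near p f" and g: "lipschitz_near p g" "g p \<noteq> 0"
  shows "lipschitz_near p (\<lambda>x. f x / g x)"
proof -
  have "lipschitz_near (g p) (inverse :: real \<Rightarrow> real)"
    by (rule lipschitz_near_C1[of "- {0}" _ _ "\<lambda>x. - inverse (x\<^sup>2)"])
      (use g in \<open>auto intro!: derivative_eq_intros continuous_intros simp: power2_eq_square\<close>)
  then have "lipschitz_near p (\<lambda>x. f x * inverse (g x))"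
    by (intro lipschitz_near_mult f lipschitz_near_compose[OF g(1)])
  then show ?thesis by (simp add: divide_inverse)
qed

lemma lipschitz_near_power:
  fixes f :: "'a::metric_space \<Rightarrow> real"
  assumes "lipschitz_near p f" shows "lipschitz_near p (\<lambda>x. f x ^ n)"
  by (induction n) (auto intro: lipschitz_near_mult assms)

lemma lipschitz_near_sqrt:
  fixes f :: "'a::metric_space \<Rightarrow> real"
  assumes f: "lipschitz_near p f" and pos: "f p > 0"
  shows "lipschitz_near p (\<lambda>x. sqrt (f x))"
  by (rule lipschitz_near_compose[OF f], rule lipschitz_near_C1[of "{0<..}" _ _ "\<lambda>x. inverse (sqrt x) / 2"])
    (use pos in \<open>auto intro!: DERIV_real_sqrt continuous_intros\<close>)

lemma lipschitz_near_sin: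
  fixes f :: "'a::metric_space \<Rightarrow> real"
  assumes "lipschitz_near p f" shows "lipschitz_near p (\<lambda>x. sin (f x))"
  by (rule lipschitz_near_compose[OF assms], rule lipschitz_near_C1[of UNIV _ _ cos])
    (auto intro!: continuous_intros)

lemma lipschitz_near_cos:
  fixes f :: "'a::metric_space \<Rightarrow> real"
  assumes "lipschitz_near p f" shows "lipschitz_near p (\<lambda>x. cos (f x))"
  by (rule lipschitz_near_compose[OF assms], rule lipschitz_near_C1[of UNIV _ _ "\<lambda>x. - sin x"])
    (auto intro!: continuous_intros)

lemma lipschitz_near_cong:
  assumes f: "lipschitz_near p f" and S: "open S" "p \<in> S" and eq: "\<And>x. x \<in> S \<Longrightarrow> g x = f x"
  shows "lipschitz_near p g"
proof -
  obtain e1 L where 1: "e1 > 0" "L-lipschitz_on (ball p e1) f"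
    using f by (auto simp: lipschitz_near_def)
  obtain e2 where e2: "e2 > 0" "ball p e2 \<subseteq> S" using S open_contains_ball by blast
  have "L-lipschitz_on (ball p (min e1 e2)) f" by (rule lipschitz_on_subset[OF 1(2)]) auto
  then have "L-lipschitz_on (ball p (min e1 e2)) g"
    by (rule lipschitz_on_transform) (use e2 eq in auto)
  moreover have "min e1 e2 > 0" using 1 e2 by simp
  ultimately show ?thesis unfolding lipschitz_near_def by blast
qed

lemmas lipschitz_near_intros = lipschitz_near_const lipschitz_near_add lipschitz_near_diff
  lipschitz_near_mult lipschitz_near_divide lipschitz_near_power lipschitz_near_sqrt
  lipschitz_near_sin lipschitz_near_cos lipschitz_near_Pair

section \<open>The potentials\<close>

context schwarzschild_isosceles
begin

definition \<kappa> :: real where "\<kappa> = (M / 2) powr (3 / 2)"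

definition \<kappa>V :: real where "\<kappa>V = (M / 2) powr (1 / 2)"

text \<open>The only irrationality in the potentials. Rewriting them in terms of \<open>\<Delta>\<close> replaces real by
  integer exponents, which makes algebraic normalization possible.\<close>

definition \<Delta> :: "real \<Rightarrow> real" where "\<Delta> \<theta> = sqrt ((cos \<theta>)\<^sup>2 + \<mu> * (sin \<theta>)\<^sup>2)"

lemma \<kappa>_pos: "\<kappa> > 0" and \<kappa>V_pos: "\<kappa>V > 0"
  using masses_pos by (auto simp: \<kappa>_def \<kappa>V_def)

lemma \<mu>_gt_1: "\<mu> > 1"
  using masses_pos by (simp add: \<mu>_def)

lemma \<Delta>_sq: "(\<Delta> \<theta>)\<^sup>2 = 1 + (\<mu> - 1) * (sin \<theta>)\<^sup>2"
  using denom_pos[of \<theta>] by (simp add: \<Delta>_def cos_squared_eq algebra_simps)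

lemma \<Delta>_ge_1: "\<Delta> \<theta> \<ge> 1"
proof -
  have "(\<Delta> \<theta>)\<^sup>2 \<ge> 1\<^sup>2" using \<mu>_gt_1 by (simp add: \<Delta>_sq)
  then show ?thesis by (rule power2_le_imp_le) (use denom_pos[of \<theta>] in \<open>simp add: \<Delta>_def\<close>)
qed

lemma \<Delta>_pos: "\<Delta> \<theta> > 0" using \<Delta>_ge_1[of \<theta>] by linarith

lemma denom_powr: "((cos \<theta>)\<^sup>2 + \<mu> * (sin \<theta>)\<^sup>2) powr (1 / 2) = \<Delta> \<theta>"
  "((cos \<theta>)\<^sup>2 + \<mu> * (sin \<theta>)\<^sup>2) powr (3 / 2) = \<Delta> \<theta> ^ 3"
proof -
  let ?D = "(cos \<theta>)\<^sup>2 + \<mu> * (sin \<theta>)\<^sup>2"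
  show 1: "?D powr (1 / 2) = \<Delta> \<theta>"
    using denom_pos[of \<theta>] by (simp add: \<Delta>_def powr_half_sqrt)
  have "?D powr (3 / 2) = (?D powr (1 / 2)) powr real 3"
    by (simp only: powr_powr) simp
  also have "\<dots> = \<Delta> \<theta> ^ 3" unfolding 1 by (rule powr_realpow[OF \<Delta>_pos])
  finally show "?D powr (3 / 2) = \<Delta> \<theta> ^ 3" .
qed

lemma U_\<Delta>: "U \<theta> = \<kappa> * (B + 16 * B1 * cos \<theta> ^ 3 / \<Delta> \<theta> ^ 3)"
  by (simp add: U_def denom_powr \<kappa>_def)

lemma Vt_\<Delta>: "Vt \<theta> = \<kappa>V * (A + 4 * A1 * cos \<theta> / \<Delta> \<theta>)"
  by (simp add: Vt_def denom_powr \<kappa>V_def)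

lemma V_\<Delta>: "V \<theta> = \<kappa>V * (A / cos \<theta> + 4 * A1 / \<Delta> \<theta>)"
  by (simp add: V_def denom_powr \<kappa>V_def)

lemma W_0: "W 0 = U 0" "W 0 = \<kappa> * (B + 16 * B1)"
  by (simp_all add: W_def U_def \<kappa>_def)

lemma \<Delta>_deriv: "(\<Delta> has_real_derivative ((\<mu> - 1) * sin \<theta> * cos \<theta> / \<Delta> \<theta>)) (at \<theta>)"
proof -
  have "((\<lambda>\<theta>. sqrt ((cos \<theta>)\<^sup>2 + \<mu> * (sin \<theta>)\<^sup>2)) has_real_derivative
      ((\<mu> - 1) * sin \<theta> * cos \<theta> / sqrt ((cos \<theta>)\<^sup>2 + \<mu> * (sin \<theta>)\<^sup>2))) (at \<theta>)"
    using denom_pos[of \<theta>]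
    by (auto intro!: derivative_eq_intros simp: field_simps)
  then show ?thesis by (simp add: \<Delta>_def[abs_def])
qed

lemma deriv_U_eq: "deriv U \<theta> = - (48 * \<kappa> * B1 * \<mu> * sin \<theta> * (cos \<theta>)\<^sup>2 / \<Delta> \<theta> ^ 5)"
proof (rule DERIV_imp_deriv)
  define s c d where "s = sin \<theta>" "c = cos \<theta>" "d = \<Delta> \<theta>"
  have d: "d > 0" using \<Delta>_pos by (simp add: s_c_d_def)
  have sc: "s\<^sup>2 + c\<^sup>2 = 1" by (simp add: s_c_d_def)
  have "d\<^sup>2 = 1 + (\<mu> - 1) * s\<^sup>2" by (simp add: s_c_d_def \<Delta>_sq)
  then have d2: "d\<^sup>2 = c\<^sup>2 + \<mu> * s\<^sup>2" using sc by algebra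
  \<comment> \<open>The two contributions to the derivative combine because \<open>(\<mu> - 1) * c\<^sup>2 + d\<^sup>2 = \<mu>\<close>.\<close>
  have "(c\<^sup>2 * ((\<mu> - 1) * c\<^sup>2 + d\<^sup>2)) * s = c\<^sup>2 * \<mu> * s"
    unfolding d2 using sc by algebra
  then have alg: "c ^ 3 * (d\<^sup>2 * ((\<mu> - 1) * s * c)) + c\<^sup>2 * s * d ^ 4 = c\<^sup>2 * \<mu> * s * d\<^sup>2"
    by algebra
  have c3: "((\<lambda>\<theta>. cos \<theta> ^ 3) has_real_derivative - (3 * c\<^sup>2 * s)) (at \<theta>)"
    by (auto intro!: derivative_eq_intros simp: s_c_d_def)
  have d3: "((\<lambda>\<theta>. \<Delta> \<theta> ^ 3) has_real_derivative 3 * d\<^sup>2 * ((\<mu> - 1) * s * c / d)) (at \<theta>)"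
    by (auto intro!: derivative_eq_intros \<Delta>_deriv simp: s_c_d_def)
  have "((\<lambda>\<theta>. \<kappa> * (B + 16 * B1 * (cos \<theta> ^ 3 / \<Delta> \<theta> ^ 3))) has_real_derivative
      (\<kappa> * (0 + 16 * B1 * ((- (3 * c\<^sup>2 * s) * \<Delta> \<theta> ^ 3 -
      cos \<theta> ^ 3 * (3 * d\<^sup>2 * ((\<mu> - 1) * s * c / d))) / (\<Delta> \<theta> ^ 3 * \<Delta> \<theta> ^ 3))))) (at \<theta>)"
    by (intro DERIV_cmult DERIV_add DERIV_divide DERIV_const c3 d3) (use \<Delta>_pos[of \<theta>] in simp)
  then have "(U has_real_derivative (\<kappa> * (16 * B1 * ((- (3 * c\<^sup>2 * s) * d ^ 3 -
      c ^ 3 * (3 * d\<^sup>2 * ((\<mu> - 1) * s * c / d))) / (d ^ 3 * d ^ 3))))) (at \<theta>)"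
    by (simp add: U_\<Delta>[abs_def] s_c_d_def)
  moreover have "\<kappa> * (16 * B1 * ((- (3 * c\<^sup>2 * s) * d ^ 3 -
      c ^ 3 * (3 * d\<^sup>2 * ((\<mu> - 1) * s * c / d))) / (d ^ 3 * d ^ 3))) =
      - (48 * \<kappa> * B1 * \<mu> * s * c\<^sup>2 / d ^ 5)"
    using d alg by (simp add: divide_simps) algebra
  ultimately show "(U has_real_derivative - (48 * \<kappa> * B1 * \<mu> * sin \<theta> * (cos \<theta>)\<^sup>2 / \<Delta> \<theta> ^ 5)) (at \<theta>)"
    by (simp add: s_c_d_def)
qed

lemma deriv_V_eq:
  assumes "cos \<theta> \<noteq> 0"
  shows "deriv V \<theta> = \<kappa>V * (A * sin \<theta> / (cos \<theta>)\<^sup>2 - 4 * A1 * (\<mu> - 1) * sin \<theta> * cos \<theta> / \<Delta> \<theta> ^ 3)"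
proof (rule DERIV_imp_deriv)
  have "((\<lambda>\<theta>. \<kappa>V * (A / cos \<theta> + 4 * A1 / \<Delta> \<theta>)) has_real_derivative
      \<kappa>V * ((0 * cos \<theta> - A * (- sin \<theta>)) / (cos \<theta> * cos \<theta>) +
        (0 * \<Delta> \<theta> - 4 * A1 * ((\<mu> - 1) * sin \<theta> * cos \<theta> / \<Delta> \<theta>)) / (\<Delta> \<theta> * \<Delta> \<theta>))) (at \<theta>)"
    by (intro DERIV_cmult DERIV_add DERIV_divide DERIV_const DERIV_cos \<Delta>_deriv)
      (use \<Delta>_pos[of \<theta>] assms in simp_all)
  then show "(V has_real_derivative \<kappa>V * (A * sin \<theta> / (cos \<theta>)\<^sup>2 -
      4 * A1 * (\<mu> - 1) * sin \<theta> * cos \<theta> / \<Delta> \<theta> ^ 3)) (at \<theta>)"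
    by (simp add: V_\<Delta>[abs_def] power2_eq_square power3_eq_cube mult.assoc)
qed

lemma cos_le_\<Delta>: "cos \<theta> / \<Delta> \<theta> \<le> 1"
  using order_trans[OF cos_le_one \<Delta>_ge_1, of \<theta> \<theta>] \<Delta>_pos[of \<theta>] by simp

lemma U_lower: "cos \<theta> \<ge> 0 \<Longrightarrow> \<kappa> * B \<le> U \<theta>"
  unfolding U_\<Delta> using \<kappa>_pos coeffs_pos \<Delta>_pos[of \<theta>] by simp

lemma U_upper: assumes "cos \<theta> \<ge> 0" shows "U \<theta> \<le> W 0"
proof -
  have "(cos \<theta> / \<Delta> \<theta>) ^ 3 \<le> 1"
    using assms \<Delta>_pos[of \<theta>] cos_le_\<Delta>[of \<theta>] by (intro power_le_one) simp_all
  then have "16 * B1 * (cos \<theta> / \<Delta> \<theta>) ^ 3 \<le> 16 * B1 * 1"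
    using coeffs_pos by (intro mult_left_mono) auto
  then show ?thesis unfolding U_\<Delta> W_0(2) using \<kappa>_pos
    by (intro mult_left_mono) (auto simp: power_divide)
qed

lemma Vt_nonneg: "cos \<theta> \<ge> 0 \<Longrightarrow> 0 \<le> Vt \<theta>"
  unfolding Vt_\<Delta> using \<kappa>V_pos coeffs_pos \<Delta>_pos[of \<theta>] by simp

lemma Vt_upper: assumes "cos \<theta> \<ge> 0" shows "Vt \<theta> \<le> Vt 0"
proof -
  have "4 * A1 * (cos \<theta> / \<Delta> \<theta>) \<le> 4 * A1 * 1"
    using coeffs_pos cos_le_\<Delta>[of \<theta>] by (intro mult_left_mono) auto
  moreover have "\<Delta> 0 = 1" by (simp add: \<Delta>_def)
  ultimately show ?thesis unfolding Vt_\<Delta> using \<kappa>V_pos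
    by (intro mult_left_mono) auto
qed

text \<open>In the variable \<open>\<tau> = (tan \<theta>)\<^sup>2\<close>, and up to a constant factor,
  \<open>W = B (1 + \<tau>) powr (3/2) + 16 B1 ((1 + \<tau>) / (1 + \<mu> \<tau>)) powr (3/2)\<close> is a sum of two convex
  functions. The inequality is the tangent inequality \<open>W \<tau> - W 0 \<le> \<tau> W' \<tau>\<close> multiplied by \<open>2 (cos \<theta>) ^ 5\<close>;
  multiplied out like this it has no singularity at \<open>cos \<theta> = 0\<close>. The two summands are treated
  separately; each reduces to a polynomial in one variable with a double zero at 1.\<close>

lemma W_convexity:
  assumes c: "cos \<theta> > 0"
  shows "2 * (cos \<theta>)\<^sup>2 * (U \<theta> - W 0 * cos \<theta> ^ 3)
    \<le> sin \<theta> * (deriv U \<theta> * cos \<theta> ^ 3 + 3 * sin \<theta> * (cos \<theta>)\<^sup>2 * U \<theta>)"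
proof -
  define s c d where "s = sin \<theta>" "c = cos \<theta>" "d = \<Delta> \<theta>"
  have d: "d \<ge> 1" "d > 0" using \<Delta>_pos \<Delta>_ge_1 by (auto simp: s_c_d_def)
  have c0: "c > 0" "c \<le> 1" using assms by (auto simp: s_c_d_def)
  have sc: "s\<^sup>2 = 1 - c\<^sup>2" by (simp add: s_c_d_def sin_squared_eq)
  have "d\<^sup>2 = 1 + (\<mu> - 1) * s\<^sup>2" by (simp add: s_c_d_def \<Delta>_sq)
  then have d2: "d\<^sup>2 = c\<^sup>2 + \<mu> * s\<^sup>2" "d\<^sup>2 - 1 = (\<mu> - 1) * s\<^sup>2"
    using sc by algebra+
  have d2': "d\<^sup>2 - \<mu> = - (\<mu> - 1) * c\<^sup>2" using d2 sc by algebra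
  have B_part: "2 * (1 - c ^ 3) \<le> 3 * s\<^sup>2"
  proof -
    have "3 * s\<^sup>2 - 2 * (1 - c ^ 3) = (1 - c)\<^sup>2 * (1 + 2 * c)"
      unfolding sc by (simp add: power2_eq_square power3_eq_cube algebra_simps)
    also have "\<dots> \<ge> 0" using c0 by simp
    finally show ?thesis by linarith
  qed
  have B1_part: "3 * (d\<^sup>2 - 1) * c\<^sup>2 \<le> 2 * (d ^ 3 - 1) * d\<^sup>2"
  proof -
    have "2 * (d ^ 3 - 1) * d\<^sup>2 - 3 * (d\<^sup>2 - 1) = (d - 1)\<^sup>2 * (2 * d ^ 3 + 4 * d\<^sup>2 + 6 * d + 3)"
      by (simp add: power2_eq_square power3_eq_cube algebra_simps)
    also have "\<dots> \<ge> 0" using d by simp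
    finally have "3 * (d\<^sup>2 - 1) \<le> 2 * (d ^ 3 - 1) * d\<^sup>2" by linarith
    moreover have "3 * (d\<^sup>2 - 1) * c\<^sup>2 \<le> 3 * (d\<^sup>2 - 1) * 1"
      using c0 d by (intro mult_left_mono) (auto simp: power_le_one)
    ultimately show ?thesis by linarith
  qed
  have B1_part': "2 * (c ^ 3 / d ^ 3 - c ^ 3) \<le> - (3 * (d\<^sup>2 - 1) * c ^ 5 / d ^ 5)"
  proof -
    have "- (3 * (d\<^sup>2 - 1) * c ^ 5 / d ^ 5) - 2 * (c ^ 3 / d ^ 3 - c ^ 3)
        = c ^ 3 / d ^ 5 * (2 * (d ^ 3 - 1) * d\<^sup>2 - 3 * (d\<^sup>2 - 1) * c\<^sup>2)"
      using d by (simp add: divide_simps) algebra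
    also have "\<dots> \<ge> 0" using B1_part c0 d by (intro mult_nonneg_nonneg) auto
    finally show ?thesis by linarith
  qed
  have eq: "s * (- (48 * \<kappa> * B1 * \<mu> * s * c\<^sup>2 / d ^ 5) * c ^ 3
        + 3 * s * c\<^sup>2 * (\<kappa> * (B + 16 * B1 * c ^ 3 / d ^ 3)))
      = c\<^sup>2 * \<kappa> * (B * (3 * s\<^sup>2) + 16 * B1 * (- (3 * (d\<^sup>2 - 1) * c ^ 5 / d ^ 5)))"
  proof -
    have "3 * s\<^sup>2 * c\<^sup>2 * (16 * B1 * c ^ 3 / d ^ 3) - 48 * B1 * \<mu> * s\<^sup>2 * c\<^sup>2 / d ^ 5 * c ^ 3
       = 48 * s\<^sup>2 * B1 * c ^ 5 / d ^ 5 * (d\<^sup>2 - \<mu>)"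
      using d by (simp add: divide_simps) algebra
    also have "\<dots> = c\<^sup>2 * (16 * B1 * (- (3 * ((\<mu> - 1) * s\<^sup>2) * c ^ 5 / d ^ 5)))"
      unfolding d2' using d by (simp add: divide_simps) algebra
    finally have *: "3 * s\<^sup>2 * c\<^sup>2 * (16 * B1 * c ^ 3 / d ^ 3) - 48 * B1 * \<mu> * s\<^sup>2 * c\<^sup>2 / d ^ 5 * c ^ 3
       = c\<^sup>2 * (16 * B1 * (- (3 * (d\<^sup>2 - 1) * c ^ 5 / d ^ 5)))"
      unfolding d2(2) .
    have "s * (- (48 * \<kappa> * B1 * \<mu> * s * c\<^sup>2 / d ^ 5) * c ^ 3
        + 3 * s * c\<^sup>2 * (\<kappa> * (B + 16 * B1 * c ^ 3 / d ^ 3)))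
      = \<kappa> * (c\<^sup>2 * (B * (3 * s\<^sup>2)) + (3 * s\<^sup>2 * c\<^sup>2 * (16 * B1 * c ^ 3 / d ^ 3)
          - 48 * B1 * \<mu> * s\<^sup>2 * c\<^sup>2 / d ^ 5 * c ^ 3))"
      by (simp add: algebra_simps power2_eq_square)
    also have "\<dots> = c\<^sup>2 * \<kappa> * (B * (3 * s\<^sup>2) + 16 * B1 * (- (3 * (d\<^sup>2 - 1) * c ^ 5 / d ^ 5)))"
      unfolding * by (simp add: algebra_simps)
    finally show ?thesis .
  qed
  have "2 * c\<^sup>2 * (\<kappa> * (B + 16 * B1 * c ^ 3 / d ^ 3) - \<kappa> * (B + 16 * B1) * c ^ 3)
     = c\<^sup>2 * \<kappa> * (B * (2 * (1 - c ^ 3)) + 16 * B1 * (2 * (c ^ 3 / d ^ 3 - c ^ 3)))"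
    by (simp add: algebra_simps)
  also have "\<dots> \<le> c\<^sup>2 * \<kappa> * (B * (3 * s\<^sup>2) + 16 * B1 * (- (3 * (d\<^sup>2 - 1) * c ^ 5 / d ^ 5)))"
    using B_part B1_part' c0 \<kappa>_pos coeffs_pos
    by (intro mult_left_mono add_mono) auto
  finally show ?thesis
    unfolding eq[symmetric] by (simp add: s_c_d_def U_\<Delta> W_0(2) deriv_U_eq)
qed

lemma lipschitz_near_\<Delta>:
  assumes "lipschitz_near p f" shows "lipschitz_near p (\<lambda>x. \<Delta> (f x))"
  unfolding \<Delta>_def using denom_pos
  by (intro lipschitz_near_intros assms) auto

text \<open>Along \<open>cos \<theta> = 0\<close> the terms with \<open>V\<close> and \<open>tan\<close> are singular, but away from it the field is
  composed of smooth functions.\<close>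

lemma lipschitz_near_field:
  assumes "cos (fst (snd (snd p))) > 0"
  shows "lipschitz_near p (field h C)"
proof -
  define th where "th = (\<lambda>p::state. fst (snd (snd p)))"
  have c0: "cos (th p) > 0" using assms by (simp add: th_def)
  have [simp]: "U (th p) \<noteq> 0" "\<Delta> (th p) \<noteq> 0" "U (th p) > 0"
    using U_pos[of "th p"] \<Delta>_pos[of "th p"] c0 by auto
  have r: "lipschitz_near p fst" and v: "lipschitz_near p (\<lambda>p. fst (snd p))"
    and th: "lipschitz_near p th" and w: "lipschitz_near p (\<lambda>p. snd (snd (snd p)))"
    unfolding th_def by (intro lipschitz_near_bounded_linear bounded_linear_intros)+
  have lU: "lipschitz_near p (\<lambda>p. U (th p))"
    unfolding U_\<Delta> by (intro lipschitz_near_intros lipschitz_near_\<Delta> th) auto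
  have lU': "lipschitz_near p (\<lambda>p. deriv U (th p))"
  proof -
    have "lipschitz_near p (\<lambda>p. - 48 * \<kappa> * B1 * \<mu> * sin (th p) * (cos (th p))\<^sup>2 / \<Delta> (th p) ^ 5)"
      by (intro lipschitz_near_intros lipschitz_near_\<Delta> th) auto
    then show ?thesis by (simp add: deriv_U_eq)
  qed
  have lV: "lipschitz_near p (\<lambda>p. V (th p))"
    unfolding V_\<Delta> using c0 by (intro lipschitz_near_intros lipschitz_near_\<Delta> th) auto
  have opn: "open {p. cos (th p) \<noteq> 0}"
    unfolding th_def by (intro open_Collect_neq continuous_intros)
  have lV': "lipschitz_near p (\<lambda>p. deriv V (th p))"
    by (rule lipschitz_near_cong[OF _ opn _ deriv_V_eq])
      (use c0 in \<open>auto intro!: lipschitz_near_intros lipschitz_near_\<Delta> th\<close>)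
  have ltan: "lipschitz_near p (\<lambda>p. tan (th p))"
    unfolding tan_def using c0 by (intro lipschitz_near_intros th) auto
  have "field h C = (\<lambda>p. (fst p * fst (snd p) * (cos (th p) ^ 3 / sqrt (U (th p))),
      (cos (th p) ^ 3 / (2 * sqrt (U (th p))) * (fst (snd p))\<^sup>2 - sqrt (U (th p)))
        + (fst p)\<^sup>2 * (2 * h * fst p + V (th p)) * (cos (th p) ^ 3 / sqrt (U (th p))),
      snd (snd (snd p)),
      1 / 2 * fst (snd p) * snd (snd (snd p)) * (cos (th p) ^ 3 / sqrt (U (th p)))
        + (fst p)\<^sup>2 * deriv V (th p) * (cos (th p) ^ 6 / U (th p))
        + deriv U (th p) / U (th p) * (cos (th p) ^ 3 - (snd (snd (snd p)))\<^sup>2 / 2)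
        + 3 * sin (th p) * (cos (th p))\<^sup>2 - 3 * (snd (snd (snd p)))\<^sup>2 * tan (th p)
        - C\<^sup>2 * fst p * sin (th p) * cos (th p) ^ 3 / U (th p)))"
    by (auto simp: field_def th_def fun_eq_iff)
  moreover have "lipschitz_near p \<dots>"
    by (intro lipschitz_near_intros r v th w lU lU' lV lV' ltan) auto
  ultimately show ?thesis by simp
qed

end

section \<open>Elementary differential inequalities\<close>

text \<open>The derivatives of a motion are taken within \<open>{0..}\<close>, which this and the following
  lemmas adopt.\<close>

lemma nondecreasing_of_deriv_nonneg:
  fixes f :: "real \<Rightarrow> real"
  assumes "0 \<le> a" "a \<le> b"
    and D: "\<And>t. a \<le> t \<Longrightarrow> t \<le> b \<Longrightarrow> (f has_real_derivative f' t) (at t within {0..})"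
    and nn: "\<And>t. a \<le> t \<Longrightarrow> t \<le> b \<Longrightarrow> 0 \<le> f' t"
  shows "f a \<le> f b"
proof (rule DERIV_nonneg_imp_increasing_open[OF assms(2)])
  fix t assume t: "a < t" "t < b"
  have "at t within {0..} = at t" using t assms(1) by (intro at_within_nhd[of _ "{0<..}"]) auto
  then show "\<exists>y. (f has_real_derivative y) (at t) \<and> 0 \<le> y"
    using D[of t] nn[of t] t by auto
next
  have "continuous (at t within {a..b}) f" if "t \<in> {a..b}" for t
    by (rule continuous_within_subset[OF DERIV_continuous[OF D]]) (use that assms(1) in auto)
  then show "continuous_on {a..b} f" by (simp add: continuous_on_eq_continuous_within)
qed

text \<open>Gronwall's inequality: \<open>f t * exp (K * t)\<close> is nondecreasing.\<close>

lemma exponential_lower_bound: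
  fixes f :: "real \<Rightarrow> real"
  assumes "0 \<le> b" and D: "\<And>t. 0 \<le> t \<Longrightarrow> t \<le> b \<Longrightarrow> (f has_real_derivative f' t) (at t within {0..})"
    and lb: "\<And>t. 0 \<le> t \<Longrightarrow> t \<le> b \<Longrightarrow> - K * f t \<le> f' t"
  shows "f 0 * exp (- K * b) \<le> f b"
proof -
  have "f 0 * exp (K * 0) \<le> f b * exp (K * b)"
  proof (rule nondecreasing_of_deriv_nonneg[OF order_refl assms(1), where f = "\<lambda>t. f t * exp (K * t)"])
    fix t assume t: "0 \<le> t" "t \<le> b"
    show "((\<lambda>t. f t * exp (K * t)) has_real_derivative (f' t + K * f t) * exp (K * t)) (at t within {0..})"
      using D[OF t] by (auto intro!: derivative_eq_intros simp: algebra_simps)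
    show "0 \<le> (f' t + K * f t) * exp (K * t)" using lb[OF t] by simp
  qed
  then have "f 0 * exp (- K * b) \<le> f b * exp (K * b) * exp (- K * b)"
    by (intro mult_right_mono) auto
  then show ?thesis by (simp add: mult.assoc flip: exp_add)
qed

text \<open>Gronwall's inequality for \<open>- f\<^sup>2\<close>; this is how a conserved zero is transported.\<close>

lemma linear_ode_zero:
  fixes f :: "real \<Rightarrow> real"
  assumes "0 \<le> b" and D: "\<And>t. 0 \<le> t \<Longrightarrow> t \<le> b \<Longrightarrow> (f has_real_derivative a t * f t) (at t within {0..})"
    and a: "continuous_on {0..b} a" and f0: "f 0 = 0"
  shows "f b = 0"
proof -
  have "bounded (a ` {0..b})" by (intro compact_imp_bounded compact_continuous_image a compact_Icc)
  then obtain N where N: "\<forall>t\<in>{0..b}. \<bar>a t\<bar> \<le> N" by (auto simp: bounded_iff)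
  have "- ((f 0)\<^sup>2) * exp (- (- 2 * N) * b) \<le> - ((f b)\<^sup>2)"
  proof (rule exponential_lower_bound[OF assms(1), where f = "\<lambda>t. - ((f t)\<^sup>2)"])
    fix t assume t: "0 \<le> t" "t \<le> b"
    show "((\<lambda>t. - ((f t)\<^sup>2)) has_real_derivative - (2 * a t * (f t)\<^sup>2)) (at t within {0..})"
      using D[OF t] by (auto intro!: derivative_eq_intros simp: power2_eq_square)
    have "a t \<le> N" using bspec[OF N, of t] t by simp
    then have "2 * a t * (f t)\<^sup>2 \<le> 2 * N * (f t)\<^sup>2"
      by (intro mult_right_mono) simp_all
    then show "- (- 2 * N) * - ((f t)\<^sup>2) \<le> - (2 * a t * (f t)\<^sup>2)" by simp
  qed
  then show ?thesis using f0 by simp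
qed

text \<open>A continuity argument: at the first time with \<open>0 \<le> f\<close>, the function was nonpositive up to then,
  which is all that the hypothesis needs.\<close>

lemma negative_if_first_zero_impossible:
  fixes f :: "real \<Rightarrow> real"
  assumes c: "continuous_on {0..b} f" and "0 \<le> b" and f0: "f 0 < 0"
    and no: "\<And>s. 0 \<le> s \<Longrightarrow> s \<le> b \<Longrightarrow> (\<And>t. 0 \<le> t \<Longrightarrow> t \<le> s \<Longrightarrow> f t \<le> 0) \<Longrightarrow> f s < 0"
  shows "f b < 0"
proof (rule ccontr)
  assume "\<not> f b < 0"
  define Z where "Z = {t \<in> {0..b}. 0 \<le> f t}"
  have "closed Z" unfolding Z_def
    using continuous_on_closed_Collect_le[OF continuous_on_const c, of 0] by simp
  moreover have "bounded Z" by (rule bounded_subset[of "{0..b}"]) (auto simp: Z_def)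
  ultimately have "compact Z" by (simp add: compact_eq_bounded_closed)
  moreover have "b \<in> Z" using \<open>\<not> f b < 0\<close> assms(2) by (auto simp: Z_def)
  ultimately obtain s where s: "s \<in> Z" "\<And>t. t \<in> Z \<Longrightarrow> s \<le> t"
    using compact_attains_inf[of Z] by blast
  have before: "f t < 0" if "0 \<le> t" "t < s" for t
    using s that by (force simp: Z_def)
  have "f s \<le> 0"
  proof (rule ccontr)
    assume "\<not> f s \<le> 0"
    moreover have "continuous_on {0..s} f" by (rule continuous_on_subset[OF c]) (use s in \<open>auto simp: Z_def\<close>)
    ultimately obtain t where "0 \<le> t" "t \<le> s" "f t = 0"
      using IVT'[of f 0 0 s] f0 s by (auto simp: Z_def)
    moreover then have "t < s" using \<open>\<not> f s \<le> 0\<close> by (cases "t = s") auto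
    ultimately show False using before by fastforce
  qed
  then have "f t \<le> 0" if "0 \<le> t" "t \<le> s" for t
    using before[of t] that by (cases "t = s") auto
  then have "f s < 0" using no[of s] s by (auto simp: Z_def)
  then show False using s by (auto simp: Z_def)
qed

lemma monotone_bounded_tendsto:
  fixes f :: "real \<Rightarrow> real"
  assumes mono: "\<And>s t. 0 \<le> s \<Longrightarrow> s \<le> t \<Longrightarrow> f s \<le> f t" and ub: "\<And>t. 0 \<le> t \<Longrightarrow> f t \<le> N"
  obtains l where "(f \<longlongrightarrow> l) at_top" "\<And>t. 0 \<le> t \<Longrightarrow> f t \<le> l"
proof -
  define l where "l = (SUP t\<in>{0..}. f t)"
  have bdd: "bdd_above (f ` {0..})" using ub by (auto intro!: bdd_aboveI)
  have le: "f t \<le> l" if "0 \<le> t" for t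
    unfolding l_def using that by (intro cSUP_upper bdd) auto
  have "(f \<longlongrightarrow> l) at_top"
  proof (rule increasing_tendsto)
    show "\<forall>\<^sub>F t in at_top. f t \<le> l" using le by (auto simp: eventually_at_top_linorder)
    fix y assume "y < l"
    then obtain s where "0 \<le> s" "y < f s"
      unfolding l_def using less_cSUP_iff[OF _ bdd] by force
    then show "\<forall>\<^sub>F t in at_top. y < f t"
      using mono unfolding eventually_at_top_linorder by (meson less_le_trans)
  qed
  with le that show ?thesis by blast
qed

text \<open>As \<open>g\<close> cannot drop quickly, each time with \<open>\<epsilon> \<le> g\<close> starts an interval of fixed length \<open>\<tau>\<close> on which
  \<open>\<epsilon> / 2 \<le> g\<close>, and there \<open>\<Psi>\<close> gains a fixed amount \<open>\<delta>\<close>. Since \<open>\<Psi>\<close> converges, this stops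
  happening eventually.\<close>

lemma tendsto_zero_of_dissipation:
  fixes g \<Psi> :: "real \<Rightarrow> real"
  assumes g0: "\<And>t. 0 \<le> t \<Longrightarrow> 0 \<le> g t"
    and dg: "\<And>t. 0 \<le> t \<Longrightarrow> (g has_real_derivative g' t) (at t within {0..})"
    and g': "\<And>t. 0 \<le> t \<Longrightarrow> - K \<le> g' t"
    and d\<Psi>: "\<And>t. 0 \<le> t \<Longrightarrow> (\<Psi> has_real_derivative \<Psi>' t) (at t within {0..})"
    and \<Psi>': "\<And>t. 0 \<le> t \<Longrightarrow> k * g t ^ n \<le> \<Psi>' t" and k: "k > 0"
    and ub: "\<And>t. 0 \<le> t \<Longrightarrow> \<Psi> t \<le> N"
  shows "(g \<longlongrightarrow> 0) at_top"
proof (rule order_tendstoI)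
  fix \<epsilon> :: real assume "\<epsilon> < 0"
  then show "\<forall>\<^sub>F t in at_top. \<epsilon> < g t"
    using g0 unfolding eventually_at_top_linorder by (meson less_le_trans)
next
  fix \<epsilon> :: real assume \<epsilon>: "\<epsilon> > 0"
  define \<tau> where "\<tau> = \<epsilon> / (2 * (\<bar>K\<bar> + 1))"
  define \<delta> where "\<delta> = k * (\<epsilon> / 2) ^ n * \<tau>"
  have \<tau>: "\<tau> > 0" and \<delta>: "\<delta> > 0" using \<epsilon> k by (auto simp: \<tau>_def \<delta>_def)
  have mono: "\<Psi> s \<le> \<Psi> t" if "0 \<le> s" "s \<le> t" for s t
  proof (rule nondecreasing_of_deriv_nonneg[OF that d\<Psi>])
    fix u assume "s \<le> u"
    then show "0 \<le> \<Psi>' u" using \<Psi>'[of u] g0[of u] k that by (smt (verit) mult_nonneg_nonneg zero_le_power)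
  qed (use that in auto)
  obtain l where l: "(\<Psi> \<longlongrightarrow> l) at_top" "\<And>t. 0 \<le> t \<Longrightarrow> \<Psi> t \<le> l"
    using monotone_bounded_tendsto[of \<Psi> N, OF mono ub] by blast
  have gain: "\<Psi> t + \<delta> \<le> l" if t: "0 \<le> t" "\<epsilon> \<le> g t" for t
  proof -
    have g2: "\<epsilon> / 2 \<le> g s" if s: "t \<le> s" "s \<le> t + \<tau>" for s
    proof -
      have "g t + K * t \<le> g s + K * s"
      proof (rule nondecreasing_of_deriv_nonneg[where f' = "\<lambda>u. g' u + K" and f = "\<lambda>u. g u + K * u"])
        fix u assume "t \<le> u"
        then have u: "0 \<le> u" using t by simp
        show "((\<lambda>u. g u + K * u) has_real_derivative g' u + K) (at u within {0..})"
          using u by (auto intro!: derivative_eq_intros dg)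
        show "0 \<le> g' u + K" using g'[OF u] by simp
      qed (use s t in auto)
      moreover have "K * (s - t) \<le> \<bar>K\<bar> * \<tau>"
        using s by (intro mult_mono) auto
      moreover have "\<bar>K\<bar> * \<tau> \<le> \<epsilon> / 2" using \<epsilon> by (simp add: \<tau>_def field_simps)
      ultimately show ?thesis using t by (simp add: algebra_simps)
    qed
    have "\<Psi> t - k * (\<epsilon> / 2) ^ n * t \<le> \<Psi> (t + \<tau>) - k * (\<epsilon> / 2) ^ n * (t + \<tau>)"
    proof (rule nondecreasing_of_deriv_nonneg[where f' = "\<lambda>u. \<Psi>' u - k * (\<epsilon> / 2) ^ n"
          and f = "\<lambda>u. \<Psi> u - k * (\<epsilon> / 2) ^ n * u"])
      fix u assume u: "t \<le> u" "u \<le> t + \<tau>"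
      show "((\<lambda>u. \<Psi> u - k * (\<epsilon> / 2) ^ n * u) has_real_derivative \<Psi>' u - k * (\<epsilon> / 2) ^ n) (at u within {0..})"
        using u t by (auto intro!: derivative_eq_intros d\<Psi>)
      have "k * (\<epsilon> / 2) ^ n \<le> k * g u ^ n"
        using g2[OF u] k \<epsilon> by (intro mult_left_mono power_mono) auto
      then show "0 \<le> \<Psi>' u - k * (\<epsilon> / 2) ^ n" using \<Psi>'[of u] u t by simp
    qed (use t \<tau> in auto)
    then have "\<Psi> t + \<delta> \<le> \<Psi> (t + \<tau>)" by (simp add: \<delta>_def algebra_simps)
    then show ?thesis using l(2)[of "t + \<tau>"] t \<tau> by linarith
  qed
  have "\<forall>\<^sub>F t in at_top. l - \<delta> < \<Psi> t" by (rule order_tendstoD(1)[OF l(1)]) (use \<delta> in simp)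
  moreover have "\<forall>\<^sub>F t in at_top. (0::real) \<le> t" by (rule eventually_ge_at_top)
  ultimately show "\<forall>\<^sub>F t in at_top. g t < \<epsilon>"
    by eventually_elim (use gain in \<open>fastforce simp: not_less[symmetric]\<close>)
qed

section \<open>Invariants of a collapsing motion\<close>

text \<open>Maximality is left out, as it enters only in the proof of \<open>T = \<infinity>\<close>; all invariants hold on
  any interval of existence.\<close>

locale collapsing_motion = schwarzschild_isosceles +
  fixes h C :: real and T :: ereal and x :: "real \<Rightarrow> state"
  assumes h_neg: "h < 0" and T_pos: "0 < T" and motion: "motion_on h C T x"
    and r_init: "0 < fst (x 0)" and \<theta>_init: "\<bar>fst (snd (snd (x 0)))\<bar> < pi / 2"
    and v_init: "fst (snd (x 0)) < - sqrt (2 * W 0)"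
    and small: "2 * fst (x 0) * Vt 0 < C\<^sup>2 / 2"
begin

definition r :: "real \<Rightarrow> real" where "r t = fst (x t)"
definition v :: "real \<Rightarrow> real" where "v t = fst (snd (x t))"
definition \<theta> :: "real \<Rightarrow> real" where "\<theta> t = fst (snd (snd (x t)))"
definition w :: "real \<Rightarrow> real" where "w t = snd (snd (snd (x t)))"
definition c :: "real \<Rightarrow> real" where "c t = cos (\<theta> t)"
definition q :: "real \<Rightarrow> real" where "q t = sqrt (U (\<theta> t))"

lemma x_eq: "x t = (r t, v t, \<theta> t, w t)"
  by (simp add: r_def v_def \<theta>_def w_def)

lemma r0_pos: "0 < r 0" using r_init by (simp add: r_def)

lemma c0_pos: "0 < c 0" using \<theta>_init by (auto simp: c_def \<theta>_def intro: cos_gt_zero_pi)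

lemma W0_pos: "0 < W 0"
  using U_pos[of 0] by (simp add: W_0(1))

lemma Vt0_pos: "0 < Vt 0"
  unfolding Vt_\<Delta> using \<kappa>V_pos coeffs_pos \<Delta>_pos[of 0]
  by (intro mult_pos_pos add_pos_pos divide_pos_pos) auto

lemma v0_neg: "v 0 < 0"
  using v_init W0_pos unfolding v_def by (smt (verit) real_sqrt_ge_zero)

lemma v0_sq: "2 * W 0 < (v 0)\<^sup>2"
proof -
  have "sqrt (2 * W 0) < - v 0" using v_init by (simp add: v_def)
  then have "(sqrt (2 * W 0))\<^sup>2 < (- v 0)\<^sup>2" using W0_pos by (intro power_strict_mono) auto
  then show ?thesis using W0_pos by simp
qed

lemma \<kappa>B_pos: "0 < \<kappa> * B" using \<kappa>_pos coeffs_pos by simp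

lemma subinterval: "0 \<le> s \<Longrightarrow> s \<le> t \<Longrightarrow> ereal t < T \<Longrightarrow> ereal s < T"
  by (meson ereal_less_eq(3) le_less_trans)

context
  fixes t :: real
  assumes t: "0 \<le> t" "ereal t < T"
begin

lemma r_nonneg: "0 \<le> r t" and c_nonneg: "0 \<le> c t"
  using motion t unfolding motion_on_def
  by (auto simp: x_eq phase_space_def c_def intro!: cos_ge_zero)

lemma \<theta>_range: "- (pi / 2) \<le> \<theta> t" "\<theta> t \<le> pi / 2"
  using motion t unfolding motion_on_def by (auto simp: x_eq phase_space_def)

lemma c_le_1: "c t \<le> 1" by (simp add: c_def)

lemma U_bounds: "\<kappa> * B \<le> U (\<theta> t)" "U (\<theta> t) \<le> W 0" "0 < U (\<theta> t)"
  using U_lower[of "\<theta> t"] U_upper[of "\<theta> t"] U_pos[of "\<theta> t"] c_nonneg by (auto simp: c_def)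

lemma q_pos: "0 < q t" and q_sq: "(q t)\<^sup>2 = U (\<theta> t)"
  using U_bounds by (auto simp: q_def)

lemma q_bounds: "sqrt (\<kappa> * B) \<le> q t" "q t \<le> sqrt (W 0)"
  using U_bounds by (auto simp: q_def)

text \<open>The energy relation solved for \<open>w\<^sup>2\<close>. It shows that \<open>w\<^sup>2\<close> vanishes like \<open>c ^ 3\<close> at double
  collision.\<close>

lemma energy_identity:
  "U (\<theta> t) * (w t)\<^sup>2 = c t ^ 3 * (2 * U (\<theta> t) - (v t)\<^sup>2 * c t ^ 3 - C\<^sup>2 * r t * c t
      + 2 * (r t)\<^sup>2 * Vt (\<theta> t) * (c t)\<^sup>2 + 2 * h * r t ^ 3 * c t ^ 3)"
proof -
  have e: "2 * h * r t ^ 3 * c t ^ 6 = U (\<theta> t) * (w t)\<^sup>2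
      + ((v t)\<^sup>2 * c t ^ 3 - 2 * U (\<theta> t)) * c t ^ 3
      + (C\<^sup>2 - 2 * r t * V (\<theta> t) * (c t)\<^sup>2) * r t * c t ^ 4"
    using motion t unfolding motion_on_def by (auto simp: x_eq energy_relation_def c_def)
  show ?thesis
  proof (cases "c t = 0")
    case True
    then show ?thesis using e by simp
  next
    case False
    then have "Vt (\<theta> t) = V (\<theta> t) * c t" using Vt_eq by (simp add: c_def)
    with e show ?thesis by algebra
  qed
qed

lemma derivs:
  shows dr: "(r has_real_derivative r t * v t * (c t ^ 3 / q t)) (at t within {0..})"
    and dv: "(v has_real_derivative (c t ^ 3 / (2 * q t) * (v t)\<^sup>2 - q t)
        + (r t)\<^sup>2 * (2 * h * r t + V (\<theta> t)) * (c t ^ 3 / q t)) (at t within {0..})"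
    and d\<theta>: "(\<theta> has_real_derivative w t) (at t within {0..})"
    and dw: "(w has_real_derivative 1 / 2 * v t * w t * (c t ^ 3 / q t)
        + (r t)\<^sup>2 * deriv V (\<theta> t) * (c t ^ 6 / U (\<theta> t))
        + deriv U (\<theta> t) / U (\<theta> t) * (c t ^ 3 - (w t)\<^sup>2 / 2)
        + 3 * sin (\<theta> t) * (c t)\<^sup>2 - 3 * (w t)\<^sup>2 * tan (\<theta> t)
        - C\<^sup>2 * r t * sin (\<theta> t) * c t ^ 3 / U (\<theta> t)) (at t within {0..})"
proof -
  have D: "(x has_vector_derivative field h C (x t)) (at t within {0..})"
    using motion t unfolding motion_on_def by blast
  note D2 = bounded_linear.has_vector_derivative[OF bounded_linear_snd D]
  note D3 = bounded_linear.has_vector_derivative[OF bounded_linear_snd D2]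
  note E = bounded_linear.has_vector_derivative[OF bounded_linear_fst D]
    bounded_linear.has_vector_derivative[OF bounded_linear_fst D2]
    bounded_linear.has_vector_derivative[OF bounded_linear_fst D3]
    bounded_linear.has_vector_derivative[OF bounded_linear_snd D3]
  note E' = E[folded has_real_derivative_iff_has_vector_derivative,
      folded r_def[abs_def] v_def[abs_def] \<theta>_def[abs_def] w_def[abs_def]]
  show "(r has_real_derivative r t * v t * (c t ^ 3 / q t)) (at t within {0..})"
    using E'(1) by (simp add: x_eq field_def c_def q_def)
  show "(v has_real_derivative (c t ^ 3 / (2 * q t) * (v t)\<^sup>2 - q t)
        + (r t)\<^sup>2 * (2 * h * r t + V (\<theta> t)) * (c t ^ 3 / q t)) (at t within {0..})"
    using E'(2) by (simp add: x_eq field_def c_def q_def)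
  show "(\<theta> has_real_derivative w t) (at t within {0..})"
    using E'(3) by (simp add: x_eq field_def)
  show "(w has_real_derivative 1 / 2 * v t * w t * (c t ^ 3 / q t)
        + (r t)\<^sup>2 * deriv V (\<theta> t) * (c t ^ 6 / U (\<theta> t))
        + deriv U (\<theta> t) / U (\<theta> t) * (c t ^ 3 - (w t)\<^sup>2 / 2)
        + 3 * sin (\<theta> t) * (c t)\<^sup>2 - 3 * (w t)\<^sup>2 * tan (\<theta> t)
        - C\<^sup>2 * r t * sin (\<theta> t) * c t ^ 3 / U (\<theta> t)) (at t within {0..})"
    using E'(4) by (simp add: x_eq field_def c_def q_def)
qed

lemma dc: "(c has_real_derivative - sin (\<theta> t) * w t) (at t within {0..})"
  unfolding c_def[abs_def] by (auto intro!: derivative_eq_intros d\<theta>)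

text \<open>On the right-hand side of \<open>energy_identity\<close> the only terms that can be positive are \<open>2 * U\<close> and the one with \<open>Vt\<close>.
  The bound is independent of \<open>v\<close>, so it survives \<open>v \<rightarrow> -\<infinity>\<close>.\<close>

lemma w_bound:
  assumes R: "r t \<le> R"
  shows "(w t)\<^sup>2 \<le> (2 + 2 * R\<^sup>2 * Vt 0 / (\<kappa> * B)) * c t ^ 3"
proof -
  have "(r t)\<^sup>2 * Vt (\<theta> t) * (c t)\<^sup>2 \<le> R\<^sup>2 * Vt 0 * 1"
    using R r_nonneg c_nonneg c_le_1 Vt_upper[of "\<theta> t"] Vt_nonneg[of "\<theta> t"]
    by (intro mult_mono power_mono power_le_one) (auto simp: c_def)
  also have "R\<^sup>2 * Vt 0 \<le> R\<^sup>2 * Vt 0 / (\<kappa> * B) * U (\<theta> t)"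
  proof -
    have "R\<^sup>2 * Vt 0 / (\<kappa> * B) * (\<kappa> * B) \<le> R\<^sup>2 * Vt 0 / (\<kappa> * B) * U (\<theta> t)"
      using U_bounds(1) \<kappa>B_pos Vt0_pos by (intro mult_left_mono divide_nonneg_pos) auto
    moreover have "R\<^sup>2 * Vt 0 / (\<kappa> * B) * (\<kappa> * B) = R\<^sup>2 * Vt 0"
      by (rule nonzero_eq_divide_eq[THEN iffD1, OF _ refl]) (use \<kappa>B_pos in auto)
    ultimately show ?thesis by simp
  qed
  finally have 1: "(r t)\<^sup>2 * Vt (\<theta> t) * (c t)\<^sup>2 \<le> R\<^sup>2 * Vt 0 / (\<kappa> * B) * U (\<theta> t)" by simp
  have 2: "h * (r t ^ 3 * c t ^ 3) \<le> 0" "0 \<le> C\<^sup>2 * r t * c t" "0 \<le> (v t)\<^sup>2 * c t ^ 3"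
    using h_neg r_nonneg c_nonneg by (auto intro: mult_nonpos_nonneg)
  have "U (\<theta> t) * (w t)\<^sup>2 \<le> c t ^ 3 * (2 * U (\<theta> t) + 2 * (R\<^sup>2 * Vt 0 / (\<kappa> * B) * U (\<theta> t)))"
    unfolding energy_identity
  proof (rule mult_left_mono)
    have "2 * (r t)\<^sup>2 * Vt (\<theta> t) * (c t)\<^sup>2 = 2 * ((r t)\<^sup>2 * Vt (\<theta> t) * (c t)\<^sup>2)"
      "2 * h * r t ^ 3 * c t ^ 3 = 2 * (h * (r t ^ 3 * c t ^ 3))" by simp_all
    with 1 2 show "2 * U (\<theta> t) - (v t)\<^sup>2 * c t ^ 3 - C\<^sup>2 * r t * c t
      + 2 * (r t)\<^sup>2 * Vt (\<theta> t) * (c t)\<^sup>2 + 2 * h * r t ^ 3 * c t ^ 3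
      \<le> 2 * U (\<theta> t) + 2 * (R\<^sup>2 * Vt 0 / (\<kappa> * B) * U (\<theta> t))" by linarith
  qed (use c_nonneg in simp)
  also have "\<dots> = U (\<theta> t) * ((2 + 2 * R\<^sup>2 * Vt 0 / (\<kappa> * B)) * c t ^ 3)"
    by (simp add: algebra_simps)
  finally show ?thesis using U_bounds(3) by simp
qed

lemma w_le_c:
  assumes R: "r t \<le> R"
  shows "\<bar>w t\<bar> \<le> sqrt (2 + 2 * R\<^sup>2 * Vt 0 / (\<kappa> * B)) * c t"
proof (rule power2_le_imp_le)
  define K where "K = 2 + 2 * R\<^sup>2 * Vt 0 / (\<kappa> * B)"
  have K: "0 \<le> K" unfolding K_def using \<kappa>B_pos Vt0_pos by (intro add_nonneg_nonneg divide_nonneg_pos) auto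
  have "(w t)\<^sup>2 \<le> K * c t ^ 3" using w_bound[OF R] by (simp add: K_def)
  also have "\<dots> \<le> K * (c t)\<^sup>2"
    using K c_nonneg c_le_1 by (intro mult_left_mono power_decreasing) auto
  finally show "\<bar>w t\<bar>\<^sup>2 \<le> (sqrt (2 + 2 * R\<^sup>2 * Vt 0 / (\<kappa> * B)) * c t)\<^sup>2"
    using K by (simp add: K_def power_mult_distrib)
  show "0 \<le> sqrt (2 + 2 * R\<^sup>2 * Vt 0 / (\<kappa> * B)) * c t"
    using K c_nonneg by (simp add: K_def)
qed

lemma dc_lower:
  assumes R: "r t \<le> R"
  shows "- sqrt (2 + 2 * R\<^sup>2 * Vt 0 / (\<kappa> * B)) * c t \<le> - sin (\<theta> t) * w t"
proof -
  have "\<bar>sin (\<theta> t) * w t\<bar> \<le> 1 * \<bar>w t\<bar>" unfolding abs_mult by (rule mult_right_mono) auto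
  then show ?thesis using w_le_c[OF R] by linarith
qed

end

lemma continuous_of_deriv:
  assumes "ereal b < T"
    and "\<And>t. 0 \<le> t \<Longrightarrow> ereal t < T \<Longrightarrow> (f has_real_derivative f' t) (at t within {0..})"
  shows "continuous_on {0..b} f"
proof -
  have "continuous (at t within {0..b}) f" if "t \<in> {0..b}" for t
    by (rule continuous_within_subset[OF DERIV_continuous[OF assms(2)]])
      (use that subinterval[of t b] assms(1) in auto)
  then show ?thesis by (simp add: continuous_on_eq_continuous_within)
qed

text \<open>Double collision is not reached in finite time, because \<open>c\<close> decreases at most exponentially. The
  rate depends on a bound for \<open>r\<close>, which here comes from continuity on a compact time interval; that
  \<open>r\<close> is monotone will only follow from \<open>0 < c\<close>.\<close>

lemma c_pos: assumes t: "0 \<le> t" "ereal t < T" shows "0 < c t"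
proof -
  have "continuous_on {0..t} r" by (rule continuous_of_deriv[OF t(2) dr])
  then have "bounded (r ` {0..t})" by (intro compact_imp_bounded compact_continuous_image compact_Icc)
  then obtain R where R: "\<forall>s\<in>{0..t}. \<bar>r s\<bar> \<le> R" by (auto simp: bounded_iff)
  have "c 0 * exp (- sqrt (2 + 2 * R\<^sup>2 * Vt 0 / (\<kappa> * B)) * t) \<le> c t"
  proof (rule exponential_lower_bound[OF t(1)])
    fix s assume s: "0 \<le> s" "s \<le> t"
    then have sT: "ereal s < T" using subinterval t by blast
    show "(c has_real_derivative - sin (\<theta> s) * w s) (at s within {0..})" by (rule dc[OF s(1) sT])
    show "- sqrt (2 + 2 * R\<^sup>2 * Vt 0 / (\<kappa> * B)) * c s \<le> - sin (\<theta> s) * w s"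
      by (rule dc_lower[OF s(1) sT]) (use bspec[OF R, of s] s in simp)
  qed
  moreover have "0 < c 0 * exp (- sqrt (2 + 2 * R\<^sup>2 * Vt 0 / (\<kappa> * B)) * t)" using c0_pos by simp
  ultimately show ?thesis by linarith
qed

text \<open>The derivative of \<open>v\<close> after \<open>v\<^sup>2\<close> has been eliminated by the energy relation; in this form its sign is
  visible.\<close>

definition v' :: "real \<Rightarrow> real" where
  "v' t = - (U (\<theta> t) * (w t)\<^sup>2 / c t ^ 3 + r t * c t * (C\<^sup>2 - 4 * r t * Vt (\<theta> t) * c t)
      - 6 * h * r t ^ 3 * c t ^ 3) / (2 * q t)"

lemma dv': assumes t: "0 \<le> t" "ereal t < T"
  shows "(v has_real_derivative v' t) (at t within {0..})"
proof -
  have c: "c t > 0" by (rule c_pos[OF t])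
  have Vt: "Vt (\<theta> t) = V (\<theta> t) * c t" using Vt_eq c by (simp add: c_def)
  have E: "U (\<theta> t) * (w t)\<^sup>2 / c t ^ 3 = 2 * (q t)\<^sup>2 - (v t)\<^sup>2 * c t ^ 3 - C\<^sup>2 * r t * c t
      + 2 * (r t)\<^sup>2 * Vt (\<theta> t) * (c t)\<^sup>2 + 2 * h * r t ^ 3 * c t ^ 3"
    using energy_identity[OF t] c by (simp add: q_sq[OF t])
  have "v' t = (c t ^ 3 / (2 * q t) * (v t)\<^sup>2 - q t)
        + (r t)\<^sup>2 * (2 * h * r t + V (\<theta> t)) * (c t ^ 3 / q t)"
    unfolding v'_def E Vt using q_pos[OF t]
    by (simp add: divide_simps) algebra
  then show ?thesis using dv[OF t] by simp
qed

text \<open>The two quantities that \<open>- v'\<close> controls. The term with \<open>h\<close> is dropped, as \<open>h < 0\<close> gives it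
  the favourable sign.\<close>

lemma dissipation:
  assumes t: "0 \<le> t" "ereal t < T" and R: "r t \<le> r 0"
  shows "U (\<theta> t) * (w t)\<^sup>2 / c t ^ 3 + r t * c t * (C\<^sup>2 - 4 * r 0 * Vt 0) \<le> 2 * q t * (- v' t)"
    and "0 \<le> C\<^sup>2 - 4 * r t * Vt (\<theta> t) * c t"
proof -
  have "r t * Vt (\<theta> t) * c t \<le> r 0 * Vt 0 * 1"
    using R r_nonneg[OF t] c_nonneg[OF t] c_le_1[OF t] r0_pos Vt0_pos Vt_upper[of "\<theta> t"] Vt_nonneg[of "\<theta> t"]
    by (intro mult_mono) (auto simp: c_def)
  then have 1: "C\<^sup>2 - 4 * r 0 * Vt 0 \<le> C\<^sup>2 - 4 * r t * Vt (\<theta> t) * c t" by simp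
  then show "0 \<le> C\<^sup>2 - 4 * r t * Vt (\<theta> t) * c t" using small by (simp add: r_def)
  have "r t * c t * (C\<^sup>2 - 4 * r 0 * Vt 0) \<le> r t * c t * (C\<^sup>2 - 4 * r t * Vt (\<theta> t) * c t)"
    using 1 r_nonneg[OF t] c_nonneg[OF t] by (intro mult_left_mono) auto
  moreover have "h * (r t ^ 3 * c t ^ 3) \<le> 0"
    using h_neg r_nonneg[OF t] c_nonneg[OF t] by (auto intro: mult_nonpos_nonneg)
  ultimately show "U (\<theta> t) * (w t)\<^sup>2 / c t ^ 3 + r t * c t * (C\<^sup>2 - 4 * r 0 * Vt 0) \<le> 2 * q t * (- v' t)"
    unfolding v'_def using q_pos[OF t] by simp
qed

lemma gap_pos: "0 < C\<^sup>2 - 4 * r 0 * Vt 0"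
  using small by (simp add: r_def)

lemma v'_nonpos:
  assumes t: "0 \<le> t" "ereal t < T" and R: "r t \<le> r 0" shows "v' t \<le> 0"
proof -
  have "0 \<le> U (\<theta> t) * (w t)\<^sup>2 / c t ^ 3 + r t * c t * (C\<^sup>2 - 4 * r 0 * Vt 0)"
    using U_bounds[OF t] c_nonneg[OF t] r_nonneg[OF t] gap_pos by (intro add_nonneg_nonneg) auto
  then have "0 \<le> 2 * q t * (- v' t)" using dissipation(1)[OF assms] by linarith
  then show ?thesis using q_pos[OF t]
    by (auto simp: mult_le_0_iff)
qed

lemma r_antimono_while_v_nonpos:
  assumes "0 \<le> s" "s \<le> t" "ereal t < T" and v: "\<And>u. s \<le> u \<Longrightarrow> u \<le> t \<Longrightarrow> v u \<le> 0"
  shows "r t \<le> r s"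
proof -
  have "- r s \<le> - r t"
  proof (rule nondecreasing_of_deriv_nonneg[OF assms(1,2), where f = "\<lambda>t. - r t"])
    fix u assume u: "s \<le> u" "u \<le> t"
    then have uT: "0 \<le> u" "ereal u < T" using assms subinterval[of u t] by auto
    show "((\<lambda>t. - r t) has_real_derivative - (r u * v u * (c u ^ 3 / q u))) (at u within {0..})"
      by (intro DERIV_minus dr uT)
    have "r u * v u \<le> 0" using r_nonneg[OF uT] v[OF u] by (simp add: mult_nonneg_nonpos)
    then show "0 \<le> - (r u * v u * (c u ^ 3 / q u))"
      using c_nonneg[OF uT] q_pos[OF uT] mult_nonpos_nonneg[of "r u * v u" "c u ^ 3 / q u"] by simp
  qed
  then show ?thesis by simp
qed

text \<open>As long as \<open>v \<le> 0\<close>, \<open>r\<close> has not exceeded its initial value, so \<open>v\<close> has not increased and is still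
  at most \<open>v 0 < 0\<close>.\<close>

lemma v_neg: assumes t: "0 \<le> t" "ereal t < T" shows "v t < 0"
proof (rule negative_if_first_zero_impossible[OF continuous_of_deriv[OF t(2) dv] t(1) v0_neg])
  fix s assume s: "0 \<le> s" "s \<le> t" and neg: "\<And>u. 0 \<le> u \<Longrightarrow> u \<le> s \<Longrightarrow> v u \<le> 0"
  have sT: "ereal s < T" using s t subinterval by blast
  have "- v 0 \<le> - v s"
  proof (rule nondecreasing_of_deriv_nonneg[OF order_refl s(1), where f = "\<lambda>t. - v t"])
    fix u assume u: "0 \<le> u" "u \<le> s"
    then have uT: "ereal u < T" using sT subinterval by blast
    show "((\<lambda>t. - v t) has_real_derivative - v' u) (at u within {0..})"
      by (intro DERIV_minus dv' u uT)
    have "r u \<le> r 0" by (rule r_antimono_while_v_nonpos) (use u uT neg in auto)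
    then show "0 \<le> - v' u" using v'_nonpos[OF u(1) uT] by simp
  qed
  then show "v s < 0" using v0_neg by simp
qed

lemma r_antimono: "0 \<le> s \<Longrightarrow> s \<le> t \<Longrightarrow> ereal t < T \<Longrightarrow> r t \<le> r s"
  by (rule r_antimono_while_v_nonpos) (auto intro!: less_imp_le[OF v_neg] dest: subinterval[rotated])

lemma r_le_r0: "0 \<le> t \<Longrightarrow> ereal t < T \<Longrightarrow> r t \<le> r 0"
  using r_antimono[of 0 t] by simp

lemma v_antimono:
  assumes "0 \<le> s" "s \<le> t" "ereal t < T" shows "v t \<le> v s"
proof -
  have "- v s \<le> - v t"
  proof (rule nondecreasing_of_deriv_nonneg[OF assms(1,2), where f = "\<lambda>t. - v t"])
    fix u assume u: "s \<le> u" "u \<le> t"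
    then have uT: "0 \<le> u" "ereal u < T" using assms subinterval[of u t] by auto
    show "((\<lambda>t. - v t) has_real_derivative - v' u) (at u within {0..})"
      by (intro DERIV_minus dv' uT)
    show "0 \<le> - v' u" using v'_nonpos[OF uT r_le_r0[OF uT]] by simp
  qed
  then show ?thesis by simp
qed

text \<open>This is \<open>v\<^sup>2 \<le> 2 * W \<theta>\<close>, multiplied by \<open>c ^ 3\<close>. On the triple collision manifold it is immediate;
  it persists for \<open>r > 0\<close> because the terms with \<open>r\<close> in the energy relation add up to the right sign.\<close>

lemma W_trap: assumes t: "0 \<le> t" "ereal t < T"
  shows "(v t)\<^sup>2 * c t ^ 3 \<le> 2 * U (\<theta> t)"
proof -
  have "0 \<le> c t ^ 3 * (2 * U (\<theta> t) - (v t)\<^sup>2 * c t ^ 3 - C\<^sup>2 * r t * c t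
      + 2 * (r t)\<^sup>2 * Vt (\<theta> t) * (c t)\<^sup>2 + 2 * h * r t ^ 3 * c t ^ 3)"
    using energy_identity[OF t] U_bounds(3)[OF t] by (metis less_imp_le zero_le_mult_iff zero_le_power2)
  then have 1: "0 \<le> 2 * U (\<theta> t) - (v t)\<^sup>2 * c t ^ 3 - C\<^sup>2 * r t * c t
      + 2 * (r t)\<^sup>2 * Vt (\<theta> t) * (c t)\<^sup>2 + 2 * h * r t ^ 3 * c t ^ 3"
    using c_pos[OF t] by (simp add: zero_le_mult_iff)
  have h: "h * (r t ^ 3 * c t ^ 3) \<le> 0"
    using h_neg r_nonneg[OF t] c_nonneg[OF t] by (auto intro: mult_nonpos_nonneg)
  have "0 \<le> r t * c t * (C\<^sup>2 - 4 * r t * Vt (\<theta> t) * c t)"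
    using dissipation(2)[OF t r_le_r0[OF t]] r_nonneg[OF t] c_nonneg[OF t] by simp
  moreover have "0 \<le> (r t)\<^sup>2 * Vt (\<theta> t) * (c t)\<^sup>2"
    using Vt_nonneg[of "\<theta> t"] c_nonneg[OF t] by (simp add: c_def)
  ultimately have "2 * (r t)\<^sup>2 * Vt (\<theta> t) * (c t)\<^sup>2 \<le> C\<^sup>2 * r t * c t"
    by (simp add: algebra_simps power2_eq_square)
  then show ?thesis using 1 h by (simp add: mult.assoc)
qed

lemma v_sq_mono: assumes t: "0 \<le> t" "ereal t < T" shows "(v 0)\<^sup>2 \<le> (v t)\<^sup>2"
  using v_antimono[OF order_refl t] v0_neg by (simp add: power2_le_iff_abs_le[symmetric] power_mono_even abs_le_square_iff[symmetric])

text \<open>At \<open>\<theta> = 0\<close> the trapping inequality reads \<open>v\<^sup>2 \<le> 2 * W 0\<close>, contrary to the initial condition on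
  \<open>v\<close>, which persists.\<close>

lemma \<theta>_nonzero: assumes t: "0 \<le> t" "ereal t < T" shows "\<theta> t \<noteq> 0"
proof
  assume "\<theta> t = 0"
  then have "(v t)\<^sup>2 \<le> 2 * W 0" using W_trap[OF t] by (simp add: c_def W_0(1))
  then show False using v_sq_mono[OF t] v0_sq by linarith
qed

text \<open>The strict initial inequality \<open>2 * W 0 < (v 0)\<^sup>2\<close> in quantitative form: the ratio of \<open>W 0\<close> to
  \<open>W \<theta>\<close> stays away from 1, uniformly up to double collision.\<close>

lemma trap_gap: assumes t: "0 \<le> t" "ereal t < T"
  shows "(1 - 2 * W 0 / (v 0)\<^sup>2) * U (\<theta> t) \<le> U (\<theta> t) - W 0 * c t ^ 3"
proof -
  have pos: "0 < (v 0)\<^sup>2" using v0_neg by simp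
  have "(v 0)\<^sup>2 * c t ^ 3 \<le> (v t)\<^sup>2 * c t ^ 3"
    using v_sq_mono[OF t] c_nonneg[OF t] by (intro mult_right_mono) auto
  then have "(v 0)\<^sup>2 * c t ^ 3 \<le> 2 * U (\<theta> t)" using W_trap[OF t] by linarith
  then have "W 0 / (v 0)\<^sup>2 * ((v 0)\<^sup>2 * c t ^ 3) \<le> W 0 / (v 0)\<^sup>2 * (2 * U (\<theta> t))"
    using W0_pos pos by (intro mult_left_mono divide_nonneg_pos) auto
  then show ?thesis using pos by (simp add: algebra_simps)
qed

lemma no_plane_crossings: "plane_crossings x T = {}"
  using \<theta>_nonzero by (fastforce simp: plane_crossings_def angle_def x_eq)

section \<open>Existence for all times\<close>

definition Kw :: real where "Kw = sqrt (2 + 2 * (r 0)\<^sup>2 * Vt 0 / (\<kappa> * B))"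

lemma Kw_nonneg: "0 \<le> Kw"
  unfolding Kw_def using \<kappa>B_pos Vt0_pos
  by (intro real_sqrt_ge_zero add_nonneg_nonneg divide_nonneg_pos) auto

lemma w_abs_le: "0 \<le> t \<Longrightarrow> ereal t < T \<Longrightarrow> \<bar>w t\<bar> \<le> Kw * c t"
  unfolding Kw_def by (rule w_le_c[OF _ _ r_le_r0])

lemma c_lower: assumes t: "0 \<le> t" "ereal t < T" shows "c 0 * exp (- Kw * t) \<le> c t"
proof (rule exponential_lower_bound[OF t(1)])
  fix s assume s: "0 \<le> s" "s \<le> t"
  then have sT: "ereal s < T" using subinterval t by blast
  show "(c has_real_derivative - sin (\<theta> s) * w s) (at s within {0..})" by (rule dc[OF s(1) sT])
  show "- Kw * c s \<le> - sin (\<theta> s) * w s"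
    unfolding Kw_def by (rule dc_lower[OF s(1) sT r_le_r0[OF s(1) sT]])
qed

lemma r_lower: assumes t: "0 \<le> t" "ereal t < T" and L: "- L \<le> v t"
  shows "r 0 * exp (- (L / sqrt (\<kappa> * B)) * t) \<le> r t"
proof (rule exponential_lower_bound[OF t(1)])
  fix s assume s: "0 \<le> s" "s \<le> t"
  then have sT: "0 \<le> s" "ereal s < T" using subinterval t by blast+
  show "(r has_real_derivative r s * v s * (c s ^ 3 / q s)) (at s within {0..})" by (rule dr[OF sT])
  have u0: "0 < sqrt (\<kappa> * B)" using \<kappa>B_pos by simp
  have "- v s \<le> L" using v_antimono[OF s t(2)] L by linarith
  moreover have "c s ^ 3 / q s \<le> 1 / sqrt (\<kappa> * B)"
    using q_bounds[OF sT] u0 c_nonneg[OF sT] c_le_1[OF sT] by (intro frac_le power_le_one) auto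
  ultimately have "- v s * (c s ^ 3 / q s) \<le> L * (1 / sqrt (\<kappa> * B))"
    using v_neg[OF sT] c_nonneg[OF sT] q_pos[OF sT] by (intro mult_mono) auto
  then have "r s * (- v s * (c s ^ 3 / q s)) \<le> r s * (L * (1 / sqrt (\<kappa> * B)))"
    using r_nonneg[OF sT] by (rule mult_left_mono)
  then show "- (L / sqrt (\<kappa> * B)) * r s \<le> r s * v s * (c s ^ 3 / q s)"
    by (simp add: algebra_simps)
qed

lemma r_pos: assumes t: "0 \<le> t" "ereal t < T" shows "0 < r t"
proof -
  have "0 < r 0 * exp (- (- v t / sqrt (\<kappa> * B)) * t)" using r0_pos by simp
  also have "\<dots> \<le> r t" by (rule r_lower[OF t]) simp
  finally show ?thesis .
qed

text \<open>The quadratic term in the equation for \<open>v\<close> is nonnegative, and the others are bounded below, so \<open>v\<close> cannot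
  escape to \<open>-\<infinity>\<close> in finite time.\<close>

lemma v_lower:
  obtains L where "0 \<le> L" "\<And>t. 0 \<le> t \<Longrightarrow> ereal t < T \<Longrightarrow> v 0 - L * t \<le> v t"
proof
  define L where "L = sqrt (W 0) - 2 * h * (r 0 ^ 3 / sqrt (\<kappa> * B))"
  have u0: "0 < sqrt (\<kappa> * B)" using \<kappa>_pos coeffs_pos by simp
  have "2 * h * (r 0 ^ 3 / sqrt (\<kappa> * B)) \<le> 0"
    using h_neg r0_pos u0 by (intro mult_nonpos_nonneg[of "2 * h"] divide_nonneg_pos) auto
  moreover have "0 \<le> sqrt (W 0)" using W0_pos by simp
  ultimately show "0 \<le> L" unfolding L_def by linarith
  fix t assume t: "0 \<le> t" "ereal t < T"
  have "v 0 + L * 0 \<le> v t + L * t"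
  proof (rule nondecreasing_of_deriv_nonneg[OF order_refl t(1), where f = "\<lambda>t. v t + L * t"])
    fix s assume s: "0 \<le> s" "s \<le> t"
    then have sT: "0 \<le> s" "ereal s < T" using subinterval t by blast+
    let ?D = "(c s ^ 3 / (2 * q s) * (v s)\<^sup>2 - q s)
        + (r s)\<^sup>2 * (2 * h * r s + V (\<theta> s)) * (c s ^ 3 / q s)"
    show "((\<lambda>t. v t + L * t) has_real_derivative ?D + L) (at s within {0..})"
      by (auto intro!: derivative_eq_intros dv[OF sT])
    have "0 \<le> V (\<theta> s) * c s"
      using Vt_eq[of "\<theta> s"] Vt_nonneg[of "\<theta> s"] c_pos[OF sT] by (simp add: c_def)
    then have V: "0 \<le> V (\<theta> s)" using c_pos[OF sT] by (simp add: zero_le_mult_iff)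
    have "(r s) ^ 3 * c s ^ 3 / q s \<le> (r 0) ^ 3 * 1 / sqrt (\<kappa> * B)"
      using q_bounds[OF sT] u0 c_nonneg[OF sT] c_le_1[OF sT] r_nonneg[OF sT] r_le_r0[OF sT] r0_pos
      by (intro frac_le mult_mono power_mono power_le_one) auto
    then have "2 * h * (r 0 ^ 3 / sqrt (\<kappa> * B)) \<le> 2 * h * (r s ^ 3 * c s ^ 3 / q s)"
      using h_neg by (intro mult_left_mono_neg) auto
    moreover have "q s \<le> sqrt (W 0)" by (rule q_bounds[OF sT])
    moreover have "0 \<le> c s ^ 3 / (2 * q s) * (v s)\<^sup>2" "0 \<le> (r s)\<^sup>2 * V (\<theta> s) * (c s ^ 3 / q s)"
      using V c_nonneg[OF sT] q_pos[OF sT] by auto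
    moreover have "(r s)\<^sup>2 * (2 * h * r s + V (\<theta> s)) * (c s ^ 3 / q s)
      = 2 * h * (r s ^ 3 * c s ^ 3 / q s) + (r s)\<^sup>2 * V (\<theta> s) * (c s ^ 3 / q s)"
      using q_pos[OF sT] by (simp add: field_simps power2_eq_square power3_eq_cube)
    ultimately show "0 \<le> ?D + L" by (simp add: L_def)
  qed
  then show "v 0 - L * t \<le> v t" by simp
qed

definition regular_states :: "state set" where
  "regular_states = {p. 0 < fst p \<and> 0 < cos (fst (snd (snd p))) \<and>
     - (pi / 2) < fst (snd (snd p)) \<and> fst (snd (snd p)) < pi / 2}"

lemma open_regular_states: "open regular_states"
  unfolding regular_states_def
  by (intro open_Collect_conj open_Collect_less continuous_intros)

lemma stays_in_compact:
  assumes T0: "T = ereal T0"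
  obtains K where "compact K" "K \<subseteq> regular_states" "\<And>t. 0 \<le> t \<Longrightarrow> t < T0 \<Longrightarrow> x t \<in> K"
proof -
  have T0_pos: "0 < T0" using T_pos T0 by (simp add: zero_ereal_def)
  obtain L where L: "0 \<le> L" "\<And>t. 0 \<le> t \<Longrightarrow> ereal t < T \<Longrightarrow> v 0 - L * t \<le> v t"
    using v_lower by blast
  define Lv where "Lv = L * T0 - v 0"
  have Lv: "- Lv \<le> v t" if "0 \<le> t" "t < T0" for t
  proof -
    have "L * t \<le> L * T0" using that L by (intro mult_left_mono) auto
    then show ?thesis using L(2)[of t] that T0 by (simp add: Lv_def)
  qed
  have "0 \<le> L * T0" using L(1) T0_pos by simp
  then have Lv0: "0 \<le> Lv" using v0_neg unfolding Lv_def by linarith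
  have u0: "0 < sqrt (\<kappa> * B)" using \<kappa>_pos coeffs_pos by simp
  define \<rho> where "\<rho> = r 0 * exp (- (Lv / sqrt (\<kappa> * B)) * T0)"
  define \<epsilon> where "\<epsilon> = c 0 * exp (- Kw * T0)"
  have \<rho>: "0 < \<rho>" and \<epsilon>: "0 < \<epsilon>" using r0_pos c0_pos by (auto simp: \<rho>_def \<epsilon>_def)
  define K where "K = {\<rho>..r 0} \<times> {- Lv..v 0} \<times> ({- (pi / 2)..pi / 2} \<inter> {th. \<epsilon> \<le> cos th}) \<times> {- Kw..Kw}"
  show ?thesis
  proof
    show "compact K" unfolding K_def
      by (intro compact_Times compact_Icc compact_Int_closed closed_Collect_le continuous_intros)
    have "- (pi / 2) < th \<and> th < pi / 2" if "th \<in> {- (pi / 2)..pi / 2}" "\<epsilon> \<le> cos th" for th :: real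
    proof -
      have "th \<noteq> pi / 2" using that(2) \<epsilon> cos_pi_half by (metis not_le)
      moreover have "th \<noteq> - (pi / 2)" using that(2) \<epsilon> cos_pi_half cos_minus by (metis not_le)
      moreover note that(1)
      ultimately show ?thesis by auto
    qed
    then show "K \<subseteq> regular_states" using \<rho> \<epsilon> by (auto simp: K_def regular_states_def)
    fix t assume t: "0 \<le> t" "t < T0"
    then have tT: "0 \<le> t" "ereal t < T" by (auto simp: T0)
    have "\<rho> \<le> r 0 * exp (- (Lv / sqrt (\<kappa> * B)) * t)"
      unfolding \<rho>_def using t Lv0 u0 r0_pos by (intro mult_left_mono) (auto simp: divide_right_mono mult_left_mono)
    also have "\<dots> \<le> r t" by (rule r_lower[OF tT Lv[OF t]])
    finally have "\<rho> \<le> r t" .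
    moreover have "\<epsilon> \<le> c t"
    proof -
      have "\<epsilon> \<le> c 0 * exp (- Kw * t)"
        unfolding \<epsilon>_def using t Kw_nonneg c0_pos by (intro mult_left_mono) (auto simp: mult_left_mono)
      also have "\<dots> \<le> c t" by (rule c_lower[OF tT])
      finally show ?thesis .
    qed
    moreover have "\<bar>w t\<bar> \<le> Kw"
      using w_abs_le[OF tT] mult_left_mono[OF c_le_1[OF tT] Kw_nonneg] by simp
    ultimately show "x t \<in> K"
      using r_le_r0[OF tT] Lv[OF t] v_antimono[OF order_refl tT] \<theta>_range[OF tT]
      by (auto simp: K_def x_eq c_def)
  qed
qed

text \<open>The energy defect satisfies a linear homogeneous equation by \<open>energy_defect_deriv\<close>, with a coefficient that
  is continuous as long as the state is regular.\<close>

lemma energy_preserved: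
  assumes y: "\<And>t. 0 \<le> t \<Longrightarrow> t < T' \<Longrightarrow> y t \<in> regular_states"
    and dy: "\<And>t. 0 \<le> t \<Longrightarrow> t < T' \<Longrightarrow> (y has_vector_derivative field h C (y t)) (at t within {0..})"
    and e0: "energy_relation h C (y 0)" and t: "0 \<le> t" "t < T'"
  shows "energy_relation h C (y t)"
proof -
  define a where "a = (\<lambda>p::state. fst (snd p) * cos (fst (snd (snd p))) ^ 3 / sqrt (U (fst (snd (snd p))))
    - 6 * snd (snd (snd p)) * tan (fst (snd (snd p))))"
  have "energy_defect h C (y t) = 0"
  proof (rule linear_ode_zero[OF t(1), where f = "\<lambda>s. energy_defect h C (y s)" and a = "\<lambda>s. a (y s)"])
    fix s assume s: "0 \<le> s" "s \<le> t"
    then have sT: "s < T'" using t by simp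
    have "((\<lambda>s. energy_defect h C (fst (y s), fst (snd (y s)), fst (snd (snd (y s))), snd (snd (snd (y s)))))
        has_real_derivative (fst (snd (y s)) * cos (fst (snd (snd (y s)))) ^ 3 / sqrt (U (fst (snd (snd (y s)))))
          - 6 * snd (snd (snd (y s))) * tan (fst (snd (snd (y s)))))
        * energy_defect h C (fst (y s), fst (snd (y s)), fst (snd (snd (y s))), snd (snd (snd (y s)))))
        (at s within {0..})"
      by (rule energy_defect_deriv) (use dy[OF s(1) sT] y[OF s(1) sT] in \<open>simp_all add: regular_states_def\<close>)
    then show "((\<lambda>s. energy_defect h C (y s)) has_real_derivative a (y s) * energy_defect h C (y s)) (at s within {0..})"
      by (simp add: a_def)
  next
    have "continuous (at s within {0..t}) y" if "s \<in> {0..t}" for s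
      by (rule continuous_within_subset[OF has_vector_derivative_continuous[OF dy]]) (use that t in auto)
    then have yc: "continuous_on {0..t} y" by (simp add: continuous_on_eq_continuous_within)
    have "continuous_on UNIV U" using isCont_U by (simp add: continuous_at_imp_continuous_on)
    then have Uc: "continuous_on regular_states (\<lambda>p. U (fst (snd (snd p))))"
      by (rule continuous_on_compose2) (auto intro!: continuous_intros)
    have "U (fst (snd (snd p))) \<noteq> 0" if "p \<in> regular_states" for p
      using U_pos[of "fst (snd (snd p))"] that by (auto simp: regular_states_def)
    then have "continuous_on regular_states a"
      unfolding a_def tan_def by (intro continuous_intros Uc) (auto simp: regular_states_def)
    then show "continuous_on {0..t} (\<lambda>s. a (y s))"
      by (rule continuous_on_compose2[OF _ yc]) (use y t in auto)
  qed (use e0 energy_defect_eq_0 in blast)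
  then show ?thesis using energy_defect_eq_0 by blast
qed

lemma exists_for_all_times:
  assumes max: "maximal_motion h C T x"
  shows "T = \<infinity>"
proof (rule ccontr)
  assume "T \<noteq> \<infinity>"
  with T_pos obtain T0 where T0: "T = ereal T0" "0 < T0" by (cases T) (auto simp: zero_ereal_def)
  obtain K where K: "compact K" "K \<subseteq> regular_states" "\<And>t. 0 \<le> t \<Longrightarrow> t < T0 \<Longrightarrow> x t \<in> K"
    using stays_in_compact[OF T0(1)] by blast
  have dx: "(x has_vector_derivative field h C (x t)) (at t within {0..})" if "0 \<le> t" "t < T0" for t
    using motion that T0 unfolding motion_on_def by auto
  have lip: "lipschitz_near p (field h C)" if "p \<in> regular_states" for p
    by (rule lipschitz_near_field) (use that in \<open>simp add: regular_states_def\<close>)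
  obtain T' y where y: "T' > T0" "\<And>t. 0 \<le> t \<Longrightarrow> t < T0 \<Longrightarrow> y t = x t"
    "\<And>t. 0 \<le> t \<Longrightarrow> t < T' \<Longrightarrow> y t \<in> regular_states"
    "\<And>t. 0 \<le> t \<Longrightarrow> t < T' \<Longrightarrow> (y has_vector_derivative field h C (y t)) (at t within {0..})"
    using bounded_solution_extends[of regular_states "field h C", OF lip open_regular_states K(1,2) T0(2) K(3) dx]
    by metis
  have e0: "energy_relation h C (y 0)"
    using motion T0 y(2)[of 0] unfolding motion_on_def by auto
  have "motion_on h C (ereal T') y"
    unfolding motion_on_def
  proof (intro allI impI)
    fix t assume "0 \<le> t \<and> ereal t < ereal T'"
    then have t: "0 \<le> t" "t < T'" by auto
    have "y t \<in> phase_space"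
      using y(3)[OF t] by (cases "y t") (auto simp: regular_states_def phase_space_def)
    then show "y t \<in> phase_space \<and> energy_relation h C (y t) \<and>
        (y has_vector_derivative field h C (y t)) (at t within {0..})"
      using y(4)[OF t] energy_preserved[OF y(3,4) e0 t] by blast
  qed
  moreover have "T < ereal T'" using T0 y(1) by simp
  moreover have "\<forall>t. 0 \<le> t \<and> ereal t < T \<longrightarrow> y t = x t" using y(2) T0 by auto
  ultimately show False using max unfolding maximal_motion_def by blast
qed

section \<open>Approach to double collision\<close>

text \<open>Immediate from \<open>W_trap\<close>, since \<open>v\<close> is monotone and therefore tends to \<open>-\<infinity>\<close>.\<close>

lemma double_collision_if_unbounded:
  assumes T: "T = \<infinity>" and unb: "\<And>L. \<exists>t\<ge>0. v t < - L"
  shows "(c \<longlongrightarrow> 0) at_top"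
proof (rule order_tendstoI)
  fix \<epsilon> :: real assume "\<epsilon> < 0"
  then show "\<forall>\<^sub>F t in at_top. \<epsilon> < c t"
    unfolding eventually_at_top_linorder using c_nonneg T by (intro exI[of _ 0]) (auto intro: less_le_trans)
next
  fix \<epsilon> :: real assume \<epsilon>: "0 < \<epsilon>"
  define L where "L = sqrt (2 * W 0 / \<epsilon> ^ 3)"
  obtain s where s: "0 \<le> s" "v s < - L" using unb by blast
  have "c t < \<epsilon>" if t: "s \<le> t" for t
  proof (rule ccontr)
    assume "\<not> c t < \<epsilon>"
    have tT: "0 \<le> t" "ereal t < T" using s t T by auto
    have L0: "0 \<le> L" "L\<^sup>2 = 2 * W 0 / \<epsilon> ^ 3" using W0_pos \<epsilon> by (auto simp: L_def)
    have "L < - v t" using v_antimono[OF s(1) t tT(2)] s(2) by linarith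
    then have "L\<^sup>2 < (- v t)\<^sup>2" using L0 by (intro power_strict_mono) auto
    then have "L\<^sup>2 * \<epsilon> ^ 3 < (v t)\<^sup>2 * \<epsilon> ^ 3" using \<epsilon> by simp
    also have "\<dots> \<le> (v t)\<^sup>2 * c t ^ 3"
      using \<open>\<not> c t < \<epsilon>\<close> \<epsilon> by (intro mult_left_mono power_mono) auto
    also have "\<dots> \<le> 2 * W 0" using W_trap[OF tT] U_bounds(2)[OF tT] by linarith
    finally show False using \<epsilon> by (simp add: L0)
  qed
  then show "\<forall>\<^sub>F t in at_top. c t < \<epsilon>" by (auto simp: eventually_at_top_linorder)
qed

text \<open>The relative depth of the trap in \<open>trap_gap\<close>.\<close>

definition \<eta> :: real where "\<eta> = 1 - 2 * W 0 / (v 0)\<^sup>2"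

lemma \<eta>_pos: "0 < \<eta>"
  using v0_sq v0_neg by (simp add: \<eta>_def divide_less_eq)

definition w' :: "real \<Rightarrow> real" where
  "w' t = 1 / 2 * v t * w t * (c t ^ 3 / q t)
        + (r t)\<^sup>2 * deriv V (\<theta> t) * (c t ^ 6 / U (\<theta> t))
        + deriv U (\<theta> t) / U (\<theta> t) * (c t ^ 3 - (w t)\<^sup>2 / 2)
        + 3 * sin (\<theta> t) * (c t)\<^sup>2 - 3 * (w t)\<^sup>2 * tan (\<theta> t)
        - C\<^sup>2 * r t * sin (\<theta> t) * c t ^ 3 / U (\<theta> t)"

text \<open>Bounds the terms of \<open>w'\<close> that carry a factor \<open>r\<close>: the attraction through \<open>V\<close> and the centrifugal
  term.\<close>

definition Kr :: real where
  "Kr = (4 * r 0 * \<kappa>V * A1 * (\<mu> - 1) + C\<^sup>2) / (\<kappa> * B)"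

text \<open>Multiplying by \<open>sin \<theta>\<close> measures the acceleration away from the plane on either side of it. The
  gradient of \<open>W\<close> contributes at least \<open>2 * \<eta> * c\<^sup>2\<close>; half of this absorbs the term \<open>v * w\<close> by the
  inequality of the means, which is where the bound on \<open>v\<close> is used. The remaining negative
  terms are multiples of \<open>w\<^sup>2 / c ^ 3\<close> and \<open>r * c\<close>, which \<open>dissipation\<close> bounds by \<open>- v'\<close>.\<close>

lemma w'_outward:
  assumes t: "0 \<le> t" "ereal t < T" and L: "- L \<le> v t"
  shows "\<eta> * (c t)\<^sup>2 - (3 + L\<^sup>2 / (16 * (\<kappa> * B) * \<eta>)) * ((w t)\<^sup>2 / c t ^ 3) - Kr * (r t * c t)
    \<le> w' t * sin (\<theta> t)"
proof -
  define s cc u0 X UU where "s = sin (\<theta> t)" "cc = c t" "u0 = \<kappa> * B" "X = (w t)\<^sup>2 / c t ^ 3" "UU = U (\<theta> t)"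
  note d = s_cc_u0_X_UU_def
  have cc: "0 < cc" "cc \<le> 1" using c_pos[OF t] c_le_1[OF t] by (auto simp: d)
  have s1: "s\<^sup>2 \<le> 1" by (simp add: d sin_squared_eq)
  have sc: "s\<^sup>2 * cc ^ n \<le> 1" for n
    by (rule mult_le_one[OF s1 _ power_le_one]) (use cc in auto)
  have u0: "0 < u0" "u0 \<le> UU" "0 < UU" using U_bounds[OF t] \<kappa>B_pos by (auto simp: d)
  have rr: "0 \<le> r t" "r t \<le> r 0" using r_nonneg[OF t] r_le_r0[OF t] by auto
  have X: "0 \<le> X" using cc by (simp add: d)
  have wX: "(w t)\<^sup>2 = X * cc ^ 3" using cc by (simp add: d)
  have UUq: "UU = (q t)\<^sup>2" using q_sq[OF t] by (simp add: d)
  have q0: "0 < q t" by (rule q_pos[OF t])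
  have drift: "- \<eta> * cc\<^sup>2 - L\<^sup>2 / (16 * u0 * \<eta>) * X \<le> 1 / 2 * v t * w t * (cc ^ 3 / q t) * s"
  proof -
    define y where "y = 1 / 2 * v t * w t * (cc\<^sup>2 / q t) * s"
    \<comment> \<open>The inequality of the means, weighted so that it costs exactly \<open>\<eta> * cc\<^sup>2\<close>.\<close>
    have "0 \<le> (\<eta> * cc + y / 2)\<^sup>2" by simp
    then have "- \<eta>\<^sup>2 * cc\<^sup>2 - y\<^sup>2 / 4 \<le> \<eta> * (cc * y)" by (simp add: power2_eq_square algebra_simps)
    then have "(- \<eta>\<^sup>2 * cc\<^sup>2 - y\<^sup>2 / 4) / \<eta> \<le> cc * y"
      using \<eta>_pos by (simp add: divide_le_eq mult.commute)
    then have 1: "- \<eta> * cc\<^sup>2 - y\<^sup>2 / (4 * \<eta>) \<le> cc * y"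
      using \<eta>_pos by (simp add: diff_divide_distrib power2_eq_square)
    have "\<bar>v t\<bar> \<le> \<bar>L\<bar>" using L v_neg[OF t] by auto
    then have "(v t)\<^sup>2 \<le> L\<^sup>2" by (simp add: abs_le_square_iff)
    then have "(v t)\<^sup>2 * X * (s\<^sup>2 * cc ^ 7) \<le> L\<^sup>2 * X * 1"
      using X cc sc by (intro mult_mono) auto
    moreover have "y\<^sup>2 = (v t)\<^sup>2 * X * (s\<^sup>2 * cc ^ 7) / (4 * UU)"
      using q0 wX unfolding y_def UUq
      by (simp add: power_mult_distrib power_divide field_simps flip: power_mult power_add)
    ultimately have "y\<^sup>2 \<le> L\<^sup>2 * X / (4 * u0)"
      using u0 X by (auto intro!: frac_le)
    then have "y\<^sup>2 / (4 * \<eta>) \<le> L\<^sup>2 * X / (4 * u0) / (4 * \<eta>)"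
      using \<eta>_pos by (intro divide_right_mono) auto
    also have "\<dots> = L\<^sup>2 / (16 * u0 * \<eta>) * X" by simp
    finally have "- \<eta> * cc\<^sup>2 - L\<^sup>2 / (16 * u0 * \<eta>) * X \<le> cc * y" using 1 by linarith
    also have "cc * y = 1 / 2 * v t * w t * (cc ^ 3 / q t) * s"
      by (simp add: y_def power2_eq_square power3_eq_cube)
    finally show ?thesis .
  qed
  have potential: "- (4 * r 0 * \<kappa>V * A1 * (\<mu> - 1) / u0) * (r t * cc)
      \<le> (r t)\<^sup>2 * deriv V (\<theta> t) * (cc ^ 6 / UU) * s"
  proof -
    define dd where "dd = \<Delta> (\<theta> t)"
    have dd: "1 \<le> dd" using \<Delta>_ge_1 by (simp add: dd_def)
    have V': "deriv V (\<theta> t) = \<kappa>V * (A * s / cc\<^sup>2 - 4 * A1 * (\<mu> - 1) * s * cc / dd ^ 3)"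
      using deriv_V_eq[of "\<theta> t"] cc by (simp add: d c_def dd_def)
    have eq: "(r t)\<^sup>2 * deriv V (\<theta> t) * (cc ^ 6 / UU) * s
       = (r t)\<^sup>2 * \<kappa>V * A * s\<^sup>2 * cc ^ 4 / UU
         - 4 * \<kappa>V * A1 * (\<mu> - 1) * (r t * cc) * (r t * (s\<^sup>2 * cc ^ 6) / (dd ^ 3 * UU))"
      unfolding V' using cc dd u0 by (simp add: divide_simps) algebra
    have "r t * (s\<^sup>2 * cc ^ 6) / (dd ^ 3 * UU) \<le> r 0 * 1 / (1 * u0)"
      using rr sc[of 6] cc dd u0 r0_pos
      by (intro frac_le mult_mono one_le_power) auto
    then have "4 * \<kappa>V * A1 * (\<mu> - 1) * (r t * cc) * (r t * (s\<^sup>2 * cc ^ 6) / (dd ^ 3 * UU))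
       \<le> 4 * \<kappa>V * A1 * (\<mu> - 1) * (r t * cc) * (r 0 * 1 / (1 * u0))"
      using \<kappa>V_pos coeffs_pos \<mu>_gt_1 rr cc by (intro mult_left_mono) auto
    moreover have "0 \<le> (r t)\<^sup>2 * \<kappa>V * A * s\<^sup>2 * cc ^ 4 / UU"
      using \<kappa>V_pos coeffs_pos cc u0 by (intro divide_nonneg_pos mult_nonneg_nonneg) auto
    ultimately show ?thesis unfolding eq by (simp add: mult_ac)
  qed
  have convexity: "2 * \<eta> * cc\<^sup>2
      \<le> (deriv U (\<theta> t) / UU * (cc ^ 3 - (w t)\<^sup>2 / 2) + 3 * s * cc\<^sup>2) * s"
  proof -
    have "2 * cc\<^sup>2 * (\<eta> * UU) \<le> 2 * cc\<^sup>2 * (UU - W 0 * cc ^ 3)"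
      using trap_gap[OF t] by (intro mult_left_mono) (auto simp: d \<eta>_def)
    also have "\<dots> \<le> s * (deriv U (\<theta> t) * cc ^ 3 + 3 * s * cc\<^sup>2 * UU)"
      using W_convexity[of "\<theta> t"] cc by (simp add: d c_def)
    finally have 1: "2 * \<eta> * cc\<^sup>2 * UU \<le> s * (deriv U (\<theta> t) * cc ^ 3 + 3 * s * cc\<^sup>2 * UU)"
      by (simp add: mult_ac)
    have "deriv U (\<theta> t) * s = - (48 * \<kappa> * B1 * \<mu> * s\<^sup>2 * cc\<^sup>2 / \<Delta> (\<theta> t) ^ 5)"
      by (simp add: deriv_U_eq d c_def power2_eq_square)
    also have "\<dots> \<le> 0"
      using \<kappa>_pos coeffs_pos mu_pos \<Delta>_pos[of "\<theta> t"] by (auto intro!: divide_nonneg_pos mult_nonneg_nonneg)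
    finally have "deriv U (\<theta> t) * s * ((w t)\<^sup>2 / 2) \<le> 0"
      by (rule mult_nonpos_nonneg) simp
    with 1 have "2 * \<eta> * cc\<^sup>2 * UU \<le> (deriv U (\<theta> t) * (cc ^ 3 - (w t)\<^sup>2 / 2) + 3 * s * cc\<^sup>2 * UU) * s"
      by (simp add: algebra_simps)
    then have "2 * \<eta> * cc\<^sup>2 \<le> (deriv U (\<theta> t) * (cc ^ 3 - (w t)\<^sup>2 / 2) + 3 * s * cc\<^sup>2 * UU) * s / UU"
      using u0 by (simp add: pos_le_divide_eq)
    also have "\<dots> = (deriv U (\<theta> t) / UU * (cc ^ 3 - (w t)\<^sup>2 / 2) + 3 * s * cc\<^sup>2) * s"
      using u0 by (simp add: field_simps)
    finally show ?thesis .
  qed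
  have tangent: "- 3 * X \<le> - 3 * (w t)\<^sup>2 * tan (\<theta> t) * s"
  proof -
    have "X * (s\<^sup>2 * cc\<^sup>2) \<le> X * 1"
      using X sc[of 2] by (intro mult_left_mono) auto
    moreover have "(w t)\<^sup>2 * tan (\<theta> t) * s = X * (s\<^sup>2 * cc\<^sup>2)"
      unfolding wX using cc by (simp add: tan_def d c_def field_simps power2_eq_square power3_eq_cube)
    ultimately show ?thesis by simp
  qed
  have momentum: "- (C\<^sup>2 / u0) * (r t * cc) \<le> - (C\<^sup>2 * r t * s * cc ^ 3 / UU) * s"
  proof -
    have "s\<^sup>2 * cc\<^sup>2 / UU \<le> 1 / u0"
      using sc[of 2] u0 by (intro frac_le) auto
    then have "C\<^sup>2 * (r t * cc) * (s\<^sup>2 * cc\<^sup>2 / UU) \<le> C\<^sup>2 * (r t * cc) * (1 / u0)"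
      using rr cc by (intro mult_left_mono) auto
    then show ?thesis by (simp add: power2_eq_square power3_eq_cube mult_ac)
  qed
  have "w' t * s = 1 / 2 * v t * w t * (cc ^ 3 / q t) * s
      + (r t)\<^sup>2 * deriv V (\<theta> t) * (cc ^ 6 / UU) * s
      + (deriv U (\<theta> t) / UU * (cc ^ 3 - (w t)\<^sup>2 / 2) + 3 * s * cc\<^sup>2) * s
      + - 3 * (w t)\<^sup>2 * tan (\<theta> t) * s + - (C\<^sup>2 * r t * s * cc ^ 3 / UU) * s"
    unfolding w'_def d by (simp add: algebra_simps)
  moreover have "Kr * (r t * cc) = 4 * r 0 * \<kappa>V * A1 * (\<mu> - 1) / u0 * (r t * cc) + C\<^sup>2 / u0 * (r t * cc)"
    by (simp add: Kr_def d add_divide_distrib distrib_right)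
  moreover have "(3 + L\<^sup>2 / (16 * u0 * \<eta>)) * X = 3 * X + L\<^sup>2 / (16 * u0 * \<eta>) * X" by (simp add: algebra_simps)
  ultimately have "\<eta> * cc\<^sup>2 - (3 + L\<^sup>2 / (16 * u0 * \<eta>)) * X - Kr * (r t * cc) \<le> w' t * s"
    using drift potential convexity tangent momentum by linarith
  then show ?thesis by (simp only: d)
qed

text \<open>Adding a large multiple \<open>- N * v\<close> to \<open>w * sin \<theta>\<close> compensates the negative terms in \<open>w'_outward\<close>.\<close>

lemma double_collision_if_bounded:
  assumes T: "T = \<infinity>" and L: "\<And>t. 0 \<le> t \<Longrightarrow> - L \<le> v t"
  shows "(c \<longlongrightarrow> 0) at_top"
proof -
  define Q where "Q = sqrt (W 0)"
  define G where "G = C\<^sup>2 - 4 * r 0 * Vt 0"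
  define u0 where "u0 = \<kappa> * B"
  define KX where "KX = 3 + L\<^sup>2 / (16 * (\<kappa> * B) * \<eta>)"
  \<comment> \<open>Large enough that \<open>- N * v'\<close> dominates both negative terms: \<open>2 * Q * (- v')\<close> bounds \<open>u0 * (w\<^sup>2 / c ^ 3) + G * (r * c)\<close>.\<close>
  define N where "N = 2 * Q * (KX / u0 + Kr / G)"
  have pos: "0 < Q" "0 < G" "0 < u0" "0 \<le> KX" "0 \<le> Kr"
    using W0_pos gap_pos \<kappa>_pos coeffs_pos \<eta>_pos r0_pos \<kappa>V_pos \<mu>_gt_1
    by (auto simp: Q_def G_def u0_def KX_def Kr_def intro!: add_nonneg_nonneg divide_nonneg_pos mult_nonneg_nonneg)
  then have N0: "0 \<le> N" by (simp add: N_def)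
  define \<Psi> where "\<Psi> = (\<lambda>t. w t * sin (\<theta> t) - N * v t)"
  show ?thesis
  proof (rule tendsto_zero_of_dissipation[where g' = "\<lambda>t. - sin (\<theta> t) * w t" and K = Kw
        and \<Psi> = \<Psi> and \<Psi>' = "\<lambda>t. w' t * sin (\<theta> t) + (w t)\<^sup>2 * c t - N * v' t" and n = 2
        and k = \<eta> and N = "Kw + N * L"])
    fix t :: real assume t0: "0 \<le> t"
    then have t: "0 \<le> t" "ereal t < T" by (auto simp: T)
    show "0 \<le> c t" by (rule c_nonneg[OF t])
    show "(c has_real_derivative - sin (\<theta> t) * w t) (at t within {0..})" by (rule dc[OF t])
    have wK: "\<bar>w t\<bar> \<le> Kw"
      using w_abs_le[OF t] mult_left_mono[OF c_le_1[OF t] Kw_nonneg] by simp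
    have "\<bar>w t * sin (\<theta> t)\<bar> \<le> \<bar>w t\<bar> * 1" unfolding abs_mult by (rule mult_left_mono) auto
    with wK have ws: "\<bar>w t * sin (\<theta> t)\<bar> \<le> Kw" by simp
    then show "- Kw \<le> - sin (\<theta> t) * w t" by (simp add: mult.commute)
    have "N * (- v t) \<le> N * L" using L[OF t0] N0 by (intro mult_left_mono) auto
    then show "\<Psi> t \<le> Kw + N * L" using ws by (simp add: \<Psi>_def)
    show "(\<Psi> has_real_derivative w' t * sin (\<theta> t) + (w t)\<^sup>2 * c t - N * v' t) (at t within {0..})"
      unfolding \<Psi>_def using dw[OF t, folded w'_def]
      by (auto intro!: derivative_eq_intros d\<theta>[OF t] dv'[OF t] simp: c_def power2_eq_square)
    have "KX * ((w t)\<^sup>2 / c t ^ 3) + Kr * (r t * c t) \<le> - N * v' t"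
    proof -
      define X where "X = (w t)\<^sup>2 / c t ^ 3"
      define Y where "Y = r t * c t"
      have XY: "0 \<le> X" "0 \<le> Y" using c_nonneg[OF t] r_nonneg[OF t] by (auto simp: X_def Y_def)
      have v': "0 \<le> - v' t" using v'_nonpos[OF t r_le_r0[OF t]] by simp
      have "u0 * X + Y * G \<le> U (\<theta> t) * X + Y * G"
        using U_bounds(1)[OF t] XY by (intro add_right_mono mult_right_mono) (auto simp: u0_def)
      also have "\<dots> \<le> 2 * q t * (- v' t)"
        using dissipation(1)[OF t r_le_r0[OF t]] by (simp add: X_def Y_def G_def)
      also have "\<dots> \<le> 2 * Q * (- v' t)"
        using q_bounds(2)[OF t] v' by (intro mult_right_mono) (auto simp: Q_def)
      finally have main: "u0 * X + Y * G \<le> 2 * Q * (- v' t)" .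
      have "KX * X + Kr * Y \<le> KX * X + Kr * Y + (KX / u0 * (Y * G) + Kr / G * (u0 * X))"
        using pos XY by simp
      also have "\<dots> = (KX / u0 + Kr / G) * (u0 * X + Y * G)"
        using pos by (simp add: field_simps)
      also have "\<dots> \<le> (KX / u0 + Kr / G) * (2 * Q * (- v' t))"
        using main pos by (intro mult_left_mono) auto
      also have "\<dots> = - N * v' t" by (simp add: N_def)
      finally show ?thesis by (simp add: X_def Y_def)
    qed
    moreover have "0 \<le> (w t)\<^sup>2 * c t" using c_nonneg[OF t] by simp
    ultimately show "\<eta> * c t ^ 2 \<le> w' t * sin (\<theta> t) + (w t)\<^sup>2 * c t - N * v' t"
      using w'_outward[OF t L[OF t0]] by (simp add: KX_def)
  qed (rule \<eta>_pos)
qed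

lemma c_tendsto_0:
  assumes "T = \<infinity>" shows "(c \<longlongrightarrow> 0) at_top"
  using double_collision_if_unbounded[OF assms] double_collision_if_bounded[OF assms] by (meson not_le)

lemma \<theta>_sign:
  assumes T: "T = \<infinity>"
  shows "(\<forall>t\<ge>0. 0 < \<theta> t) \<or> (\<forall>t\<ge>0. \<theta> t < 0)"
proof -
  have c: "continuous_on {0..t} \<theta>" for t by (rule continuous_of_deriv[OF _ d\<theta>]) (auto simp: T)
  have nz: "\<theta> t \<noteq> 0" if "0 \<le> t" for t using \<theta>_nonzero[of t] that T by simp
  show ?thesis
  proof (cases "0 < \<theta> 0")
    case True
    have "0 < \<theta> t" if "0 \<le> t" for t
      using IVT2'[of \<theta> t 0 0] c[of t] True nz that by (meson less_imp_le not_le)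
    then show ?thesis by blast
  next
    case False
    have "\<theta> t < 0" if "0 \<le> t" for t
      using IVT'[of \<theta> 0 0 t] c[of t] False nz that by (meson less_imp_le not_le)
    then show ?thesis by blast
  qed
qed

text \<open>The strict inequality holds because \<open>r\<close> is strictly decreasing on \<open>{0..1}\<close>, where \<open>r\<close>, \<open>c\<close> and
  \<open>- v\<close> are positive.\<close>

lemma r_limit:
  assumes T: "T = \<infinity>"
  obtains \<rho> where "(r \<longlongrightarrow> \<rho>) at_top" "0 \<le> \<rho>" "\<rho> < r 0"
proof -
  obtain l where l: "((\<lambda>t. - r t) \<longlongrightarrow> l) at_top" "\<And>t. 0 \<le> t \<Longrightarrow> - r t \<le> l"
    using monotone_bounded_tendsto[of "\<lambda>t. - r t" 0] r_antimono r_nonneg T by auto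
  have lim: "(r \<longlongrightarrow> - l) at_top" using tendsto_minus[OF l(1)] by simp
  have "\<forall>\<^sub>F t in at_top. 0 \<le> r t"
    using r_nonneg T by (auto simp: eventually_at_top_linorder)
  from tendsto_lowerbound[OF lim this] have "0 \<le> - l" by simp
  moreover have "r 1 < r 0"
  proof (rule DERIV_neg_imp_decreasing_open[of 0 1 r])
    fix t :: real assume t: "0 < t" "t < 1"
    then have tT: "0 \<le> t" "ereal t < T" by (auto simp: T)
    have "at t within {0..} = at t" using t by (intro at_within_nhd[of _ "{0<..}"]) auto
    then have "(r has_real_derivative r t * v t * (c t ^ 3 / q t)) (at t)" using dr[OF tT] by simp
    moreover have "r t * v t * (c t ^ 3 / q t) < 0"
      using r_pos[OF tT] v_neg[OF tT] c_pos[OF tT] q_pos[OF tT]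
      by (intro mult_neg_pos mult_pos_neg divide_pos_pos) auto
    ultimately show "\<exists>y. (r has_real_derivative y) (at t) \<and> y < 0" by blast
  next
    show "continuous_on {0..1} r" by (rule continuous_of_deriv[OF _ dr]) (auto simp: T)
  qed simp
  ultimately show ?thesis using that[of "- l"] lim l(2)[of 1] by simp
qed

lemma tends_to_double_collision:
  assumes T: "T = \<infinity>"
  shows "\<exists>\<rho>. 0 \<le> \<rho> \<and> \<rho> < r 0 \<and> (tends_to_set x T (B_plus \<rho>) \<or> tends_to_set x T (B_minus \<rho>))"
proof -
  obtain \<rho> where \<rho>: "(r \<longlongrightarrow> \<rho>) at_top" "0 \<le> \<rho>" "\<rho> < r 0" using r_limit[OF T] by blast
  have w: "(w \<longlongrightarrow> 0) at_top"
  proof (rule Lim_null_comparison)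
    show "\<forall>\<^sub>F t in at_top. norm (w t) \<le> Kw * c t"
      using w_abs_le T by (auto simp: eventually_at_top_linorder)
    show "((\<lambda>t. Kw * c t) \<longlongrightarrow> 0) at_top" using tendsto_mult_right_zero[OF c_tendsto_0[OF T]] .
  qed
  have "isCont arccos (0::real)" by (rule isCont_arccos) auto
  from isCont_tendsto_compose[OF this c_tendsto_0[OF T]]
  have ac: "((\<lambda>t. arccos (c t)) \<longlongrightarrow> pi / 2) at_top" by simp
  have abs: "((\<lambda>t. \<bar>\<theta> t\<bar>) \<longlongrightarrow> pi / 2) at_top"
  proof (rule Lim_transform_eventually[OF ac])
    have "arccos (c t) = \<bar>\<theta> t\<bar>" if "0 \<le> t" for t
    proof -
      have "\<bar>\<theta> t\<bar> \<le> pi / 2" using \<theta>_range[of t] that T by auto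
      then have "arccos (cos \<bar>\<theta> t\<bar>) = \<bar>\<theta> t\<bar>" by (intro arccos_cos) auto
      then show ?thesis by (simp add: c_def)
    qed
    then show "\<forall>\<^sub>F t in at_top. arccos (c t) = \<bar>\<theta> t\<bar>" by (auto simp: eventually_at_top_linorder)
  qed
  have lim: "((\<lambda>t. infdist (x t) S) \<longlongrightarrow> 0) at_top"
    if \<alpha>: "(\<theta> \<longlongrightarrow> \<alpha>) at_top" and S: "\<And>a. (\<rho>, a, \<alpha>, 0) \<in> S" for S \<alpha>
  proof (rule Lim_null_comparison)
    have "infdist (x t) S \<le> norm (r t - \<rho>, 0 :: real, \<theta> t - \<alpha>, w t - 0)" for t
      using infdist_le[OF S[of "v t"], of "x t"] by (simp add: x_eq dist_norm)
    then show "\<forall>\<^sub>F t in at_top. norm (infdist (x t) S) \<le> norm (r t - \<rho>, 0 :: real, \<theta> t - \<alpha>, w t - 0)"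
      by (simp add: infdist_nonneg)
    have "((\<lambda>t. (r t - \<rho>, 0 :: real, \<theta> t - \<alpha>, w t - 0)) \<longlongrightarrow> (\<rho> - \<rho>, 0, \<alpha> - \<alpha>, 0 - 0)) at_top"
      by (intro tendsto_intros \<rho>(1) \<alpha> w)
    from tendsto_norm[OF this]
    show "((\<lambda>t. norm (r t - \<rho>, 0 :: real, \<theta> t - \<alpha>, w t - 0)) \<longlongrightarrow> 0) at_top" by (simp add: norm_Pair)
  qed
  from \<theta>_sign[OF T] show ?thesis
  proof
    assume "\<forall>t\<ge>0. 0 < \<theta> t"
    then have "(\<theta> \<longlongrightarrow> pi / 2) at_top"
      by (intro Lim_transform_eventually[OF abs]) (auto simp: eventually_at_top_linorder intro!: exI[of _ 0])
    then have "tends_to_set x T (B_plus \<rho>)"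
      unfolding tends_to_set_def by (simp add: towards_def T lim B_plus_def)
    then show ?thesis using \<rho> by blast
  next
    assume neg: "\<forall>t\<ge>0. \<theta> t < 0"
    have "(\<theta> \<longlongrightarrow> - (pi / 2)) at_top"
      by (rule Lim_transform_eventually[OF tendsto_minus[OF abs]])
        (use neg in \<open>auto simp: eventually_at_top_linorder intro!: exI[of _ 0]\<close>)
    then have "tends_to_set x T (B_minus \<rho>)"
      unfolding tends_to_set_def by (simp add: towards_def T lim B_minus_def)
    then show ?thesis using \<rho> by blast
  qed
qed

end

theorem corollary5:
  fixes M m A A1 B B1 h C r0 v0 \<theta>0 w0 :: real
    and T :: ereal and x :: "real \<Rightarrow> state"
  assumes "schwarzschild_isosceles M m A A1 B B1"
    and "h < 0"
    and "schwarzschild_isosceles.maximal_motion M m A A1 B B1 h C T x"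
    and "x 0 = (r0, v0, \<theta>0, w0)"
    and "r0 > 0" and "\<bar>\<theta>0\<bar> < pi / 2"
    and "2 * r0 * schwarzschild_isosceles.Vt M m A A1 0 < C\<^sup>2 / 2"
    and "v0 < - sqrt (2 * schwarzschild_isosceles.W M m B B1 0)"
  shows "(\<exists>\<rho>. 0 \<le> \<rho> \<and> \<rho> < r0 \<and>
            (tends_to_set x T (B_plus \<rho>) \<or> tends_to_set x T (B_minus \<rho>))) \<and>
         (tends_to_set x T (B_plus 0) \<or> tends_to_set x T (B_minus 0) \<longrightarrow>
            finite (plane_crossings x T))"
proof -
  interpret schwarzschild_isosceles M m A A1 B B1 by (rule assms(1))
  interpret collapsing_motion M m A A1 B B1 h C T x
    by unfold_locales (use assms(2-8) in \<open>auto simp: maximal_motion_def\<close>)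
  have "r 0 = r0" by (simp add: r_def assms(4))
  then show ?thesis
    using tends_to_double_collision[OF exists_for_all_times[OF assms(3)]] no_plane_crossings by simp
qed

end
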